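(* Let $G=(A\cup B,E,w)$ be a vertex-weighted bipartite graph (with $A$ and $B$ independent sets and $w\colon A\cup B\to\mathbb{N}$) such that no vertex of $B$ is isolated, let $w_{\max}^B=\max_{b\in B}w(b)$, and let $q\in\mathbb{N}_0$ with $q\ge w_{\max}^B$. Then a balanced expansion $(A_1,A_2,f,q)$ for $G$ can be computed in $\mathcal{O}(|V|\,|E|)$ time, where $V=A\cup B$. Furthermore, if $w(A)+w(B)\ge q|A|$, then (for the computed balanced expansion) $A_1\neq\varnothing$.
   Context: For $S\subseteq A\cup B$, $w(S)=\sum_{v\in S}w(v)$, and $N(\cdot)$ denotes the neighborhood in $G$ (for a set $S$, $N(S)=\bigcup_{v\in S}N(v)\setminus S$). Given $q\in\mathbb{N}_0$, a partition $A_1\cup A_2$ of $A$ (parts may be empty) and a function $f\colon B\to A$, the tuple $(A_1,A_2,f,q)$ is a balanced expansion if: (1) $w(a)+w(f^{-1}(a))\ge q-w_{\max}^B+1$ for every $a\in A_1$, and $w(a)+w(f^{-1}(a))\le q+w_{\max}^B-1$ for every $a\in A_2$; (2) $f(b)\in N(b)$ for every $b\in B$; (3) $N(f^{-1}(A_1))\subseteq A_1$. The model of computation is the RAM with word size $\mathcal{O}(\log(|V|+\max_v w(v)))$. *)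

theory Defs
  imports Complex_Main
begin

section \<open>Vertex-weighted bipartite graphs and balanced expansions\<close>

text \<open>Weights are positive: the natural numbers without zero.\<close>

definition weighted_bipartite_graph ::
    "'v set \<Rightarrow> 'v set \<Rightarrow> 'v set set \<Rightarrow> ('v \<Rightarrow> nat) \<Rightarrow> bool" where
  "weighted_bipartite_graph A B E w \<longleftrightarrow>
     finite A \<and> finite B \<and> A \<inter> B = {} \<and>
     (\<forall>e\<in>E. \<exists>a\<in>A. \<exists>b\<in>B. e = {a, b}) \<and>
     (\<forall>v\<in>A \<union> B. 0 < w v)"

definition nbh :: "'v set set \<Rightarrow> 'v \<Rightarrow> 'v set" where
  "nbh E v = {u. {v, u} \<in> E}"

definition nbh_set :: "'v set set \<Rightarrow> 'v set \<Rightarrow> 'v set" where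
  "nbh_set E S = (\<Union>v\<in>S. nbh E v) - S"

abbreviation weight :: "('v \<Rightarrow> nat) \<Rightarrow> 'v set \<Rightarrow> nat" where
  "weight w S \<equiv> (\<Sum>v\<in>S. w v)"

text \<open>
  A function from \<open>B\<close> to \<open>A\<close> is a total function mapping \<open>B\<close> into \<open>A\<close>; preimages are taken
  within \<open>B\<close>. The bounds are stated over the integers to avoid truncated subtraction.
\<close>

definition balanced_expansion ::
    "'v set \<Rightarrow> 'v set \<Rightarrow> 'v set set \<Rightarrow> ('v \<Rightarrow> nat) \<Rightarrow>
     'v set \<Rightarrow> 'v set \<Rightarrow> ('v \<Rightarrow> 'v) \<Rightarrow> nat \<Rightarrow> bool" where
  "balanced_expansion A B E w A1 A2 f q \<longleftrightarrow>
     A1 \<union> A2 = A \<and> A1 \<inter> A2 = {} \<and> f ` B \<subseteq> A \<and>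
     (\<forall>a\<in>A1. int (w a) + int (weight w (B \<inter> f -` {a})) \<ge> int q - int (Max (w ` B)) + 1) \<and>
     (\<forall>a\<in>A2. int (w a) + int (weight w (B \<inter> f -` {a})) \<le> int q + int (Max (w ` B)) - 1) \<and>
     (\<forall>b\<in>B. f b \<in> nbh E b) \<and>
     nbh_set E (B \<inter> f -` A1) \<subseteq> A1"


section \<open>The word RAM\<close>

text \<open>
  A program is a finite list of instructions; registers and memory cells hold \<open>W\<close>-bit words,
  represented by natural numbers below \<open>2 ^ W\<close>, and each instruction takes one time step.
  Every computed value is reduced modulo \<open>2 ^ W\<close>, so in particular every address used
  by \<open>Load\<close> and \<open>Store\<close> is a word. The machine halts when the program counter leaves the program.
\<close>

datatype binop = Add | Sub | Mul | Div | Mod | And | Or | Xor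

fun word_op :: "nat \<Rightarrow> binop \<Rightarrow> nat \<Rightarrow> nat \<Rightarrow> nat" where
  "word_op W Add x y = (x + y) mod 2 ^ W"
| "word_op W Sub x y = (x + 2 ^ W - y) mod 2 ^ W"
| "word_op W Mul x y = (x * y) mod 2 ^ W"
| "word_op W Div x y = (x div y) mod 2 ^ W"
| "word_op W Mod x y = (x mod y) mod 2 ^ W"
| "word_op W And x y = (Bit_Operations.and x y) mod 2 ^ W"
| "word_op W Or x y = (Bit_Operations.or x y) mod 2 ^ W"
| "word_op W Xor x y = (Bit_Operations.xor x y) mod 2 ^ W"

datatype instr =
    Const nat nat          \<comment> \<open>\<open>Const i k\<close>: \<open>r\<^sub>i := k\<close>\<close>
  | Arith binop nat nat nat \<comment> \<open>\<open>Arith op i j k\<close>: \<open>r\<^sub>i := r\<^sub>j op r\<^sub>k\<close>\<close>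
  | Load nat nat           \<comment> \<open>\<open>Load i j\<close>: \<open>r\<^sub>i := M[r\<^sub>j]\<close>\<close>
  | Store nat nat          \<comment> \<open>\<open>Store i j\<close>: \<open>M[r\<^sub>i] := r\<^sub>j\<close>\<close>
  | Jump nat               \<comment> \<open>\<open>Jump l\<close>: continue at instruction \<open>l\<close>\<close>
  | JumpLess nat nat nat   \<comment> \<open>\<open>JumpLess i j l\<close>: continue at \<open>l\<close> if \<open>r\<^sub>i < r\<^sub>j\<close>\<close>

record config =
  pc :: nat
  reg :: "nat \<Rightarrow> nat"
  mem :: "nat \<Rightarrow> nat"

fun exec_instr :: "nat \<Rightarrow> instr \<Rightarrow> config \<Rightarrow> config" where
  "exec_instr W (Const i k) s =
     s\<lparr>pc := Suc (pc s), reg := (reg s)(i := k mod 2 ^ W)\<rparr>"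
| "exec_instr W (Arith oper i j k) s =
     s\<lparr>pc := Suc (pc s), reg := (reg s)(i := word_op W oper (reg s j) (reg s k))\<rparr>"
| "exec_instr W (Load i j) s =
     s\<lparr>pc := Suc (pc s), reg := (reg s)(i := mem s (reg s j))\<rparr>"
| "exec_instr W (Store i j) s =
     s\<lparr>pc := Suc (pc s), mem := (mem s)(reg s i := reg s j)\<rparr>"
| "exec_instr W (Jump l) s = s\<lparr>pc := l\<rparr>"
| "exec_instr W (JumpLess i j l) s =
     s\<lparr>pc := (if reg s i < reg s j then l else Suc (pc s))\<rparr>"

definition halted :: "instr list \<Rightarrow> config \<Rightarrow> bool" where
  "halted P s \<longleftrightarrow> length P \<le> pc s"

definition step :: "nat \<Rightarrow> instr list \<Rightarrow> config \<Rightarrow> config" where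
  "step W P s = (if halted P s then s else exec_instr W (P ! pc s) s)"

text \<open>The input occupies the memory cells from address 0 on; everything else is zero.\<close>

definition init_config :: "nat list \<Rightarrow> config" where
  "init_config xs =
     \<lparr>pc = 0, reg = (\<lambda>_. 0), mem = (\<lambda>i. if i < length xs then xs ! i else 0)\<rparr>"

definition halts_within :: "nat \<Rightarrow> instr list \<Rightarrow> nat list \<Rightarrow> nat \<Rightarrow> config \<Rightarrow> bool" where
  "halts_within W P xs T s \<longleftrightarrow>
     (\<exists>t\<le>T. s = (step W P ^^ t) (init_config xs) \<and> halted P s)"


section \<open>Encoding of inputs and outputs\<close>

text \<open>
  The vertices are numbered by their positions in \<open>as @ bs\<close>, where \<open>as\<close> and \<open>bs\<close> enumerate
  \<open>A\<close> and \<open>B\<close> in an arbitrary order. The adjacency lists \<open>adj\<close> refer to these numbers,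
  again in an arbitrary order, and are stored one after the other, preceded by a table of
  their start offsets.
\<close>

definition enumerates :: "'v list \<Rightarrow> 'v set \<Rightarrow> bool" where
  "enumerates vs V \<longleftrightarrow> distinct vs \<and> set vs = V"

definition adjacency_lists :: "'v set set \<Rightarrow> 'v list \<Rightarrow> nat list list \<Rightarrow> bool" where
  "adjacency_lists E vs adj \<longleftrightarrow>
     length adj = length vs \<and>
     (\<forall>i<length vs. enumerates (adj ! i) {j. j < length vs \<and> {vs ! i, vs ! j} \<in> E})"

definition input_words ::
    "('v \<Rightarrow> nat) \<Rightarrow> nat \<Rightarrow> 'v list \<Rightarrow> 'v list \<Rightarrow> nat list list \<Rightarrow> nat list" where
  "input_words w q as bs adj =
     [length as, length bs, q] @
     map w (as @ bs) @
     map (\<lambda>i. \<Sum>j<i. length (adj ! j)) [0..<length adj + 1] @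
     concat adj"

text \<open>
  On output, the cell with the number of a vertex \<open>a\<close> of \<open>A\<close> tells whether \<open>a\<close> lies in \<open>A1\<close>
  (1) or not (0), and the cell with the number of a vertex \<open>b\<close> of \<open>B\<close> contains the number of \<open>f b\<close>.
\<close>

definition output_encodes ::
    "'v list \<Rightarrow> 'v list \<Rightarrow> 'v set \<Rightarrow> ('v \<Rightarrow> 'v) \<Rightarrow> (nat \<Rightarrow> nat) \<Rightarrow> bool" where
  "output_encodes as bs A1 f M \<longleftrightarrow>
     (\<forall>i<length as. M i = (if as ! i \<in> A1 then 1 else 0)) \<and>
     (\<forall>j<length bs. M (length as + j) < length as \<and> as ! M (length as + j) = f (bs ! j))"

end

theory Submission
  imports Defs
begin

text \<open>
  The vertices of \<open>B\<close> are unsplittable tokens, each hosted by a neighbour in \<open>A\<close>. A vertex of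
  \<open>A\<close> is active if its load exceeds \<open>q\<close>, and a sink if its load is at most \<open>q\<close> minus the
  maximal token weight. As in push-relabel flow algorithms, the label of a host exceeds the labels
  of the neighbours of its tokens by at most one; an active vertex passes a token to a
  neighbour of that token with smaller label, or raises its own label. A vertex that gives a
  token away does not become a sink, and a sink that receives one does not become active, so sinks
  keep label 0 and labels are lower bounds for the distance to a sink. Since tokens
  are moved as a whole, every move is paid for by the advance of an adjacency pointer, and each of
  the \<open>|B| + 1\<close> label values costs one scan of all adjacency lists. In the end all active
  vertices have label \<open>|B| + 1\<close>, and some positive label \<open>k\<close> up to \<open>|B| + 1\<close> belongs to no host
  of a token; \<open>A1\<close> consists of the vertices with label at least \<open>k\<close>, or of all of \<open>A\<close> if
  there is no sink. If \<open>A1\<close> is empty, then all loads are at most \<open>q\<close> and some sink lies strictly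
  below, so the total weight is less than \<open>q |A|\<close>.
\<close>

section \<open>Flat while programs on the word RAM\<close>

text \<open>The obstacle is that a token may change its host many times, so inspecting its
  neighbourhood anew for every host would exceed the time budget. Therefore a token carries a label
  and an adjacency pointer of its own, which survive its moves: its list is scanned at most once per
  value of its label, whoever hosts it. The label of the token also mediates between its host and
  its neighbours: the host is at most one above it, the neighbours are never below it. A free level
  \<open>k\<close> absorbs exactly this drop of one: a host of a token with label at least
  \<open>k\<close> is strictly above \<open>k\<close>, so its tokens have label at least
  \<open>k\<close>. Free levels exist by pigeonhole, as |B| tokens cannot occupy |B| + 1 levels, and
  this replaces an explicit search for the vertices that reach a sink. The number of levels is tied
  to |B| rather than |A| because |B| is at most |E| when no vertex of B is isolated, whereas
  isolated vertices of A may outnumber the edges.\<close>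

type_synonym store = "(nat \<Rightarrow> nat) \<times> (nat \<Rightarrow> nat)"

datatype blk =
    SetC nat nat
  | Op binop nat nat nat
  | Get nat nat
  | Put nat nat
  | Skip
  | Seq blk blk (infixr ";;" 60)
  | Cond nat nat blk blk

fun sem :: "nat \<Rightarrow> blk \<Rightarrow> store \<Rightarrow> store" where
  "sem W (SetC i k) s = ((fst s)(i := k mod 2 ^ W), snd s)"
| "sem W (Op oper i j k) s = ((fst s)(i := word_op W oper (fst s j) (fst s k)), snd s)"
| "sem W (Get i j) s = ((fst s)(i := snd s (fst s j)), snd s)"
| "sem W (Put i j) s = (fst s, (snd s)(fst s i := fst s j))"
| "sem W Skip s = s"
| "sem W (b ;; c) s = sem W c (sem W b s)"
| "sem W (Cond i j b c) s = (if fst s i < fst s j then sem W b s else sem W c s)"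

text \<open>Blocks are free of loops, so their length bounds their running time.\<close>

fun len :: "blk \<Rightarrow> nat" where
  "len (b ;; c) = len b + len c"
| "len (Cond i j b c) = len b + len c + 2"
| "len Skip = 0"
| "len _ = 1"

text \<open>Jump targets are absolute, hence the start address \<open>l\<close>. The negative branch
  \<open>c\<close> comes first because a failed \<open>JumpLess\<close> falls through.\<close>

fun code :: "nat \<Rightarrow> blk \<Rightarrow> instr list" where
  "code l (SetC i k) = [Const i k]"
| "code l (Op oper i j k) = [Arith oper i j k]"
| "code l (Get i j) = [Load i j]"
| "code l (Put i j) = [Store i j]"
| "code l Skip = []"
| "code l (b ;; c) = code l b @ code (l + len b) c"
| "code l (Cond i j b c) =
     JumpLess i j (l + len c + 2) # code (Suc l) c @
     Jump (l + len c + 2 + len b) # code (l + len c + 2) b"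

lemma length_code [simp]: "length (code l b) = len b"
  by (induction l b rule: code.induct) auto

definition cfg :: "nat \<Rightarrow> store \<Rightarrow> config" where
  "cfg l s = \<lparr>pc = l, reg = fst s, mem = snd s\<rparr>"

text \<open>The time is an upper bound instead of an exact count, so that both branches of a
  conditional can share one bound.\<close>

definition reaches :: "nat \<Rightarrow> instr list \<Rightarrow> config \<Rightarrow> nat \<Rightarrow> config \<Rightarrow> bool" where
  "reaches W P s T s' \<longleftrightarrow> (\<exists>t\<le>T. (step W P ^^ t) s = s')"

lemma reaches_refl: "reaches W P s 0 s"
  by (auto simp: reaches_def)

lemma reaches_step: "step W P s = s' \<Longrightarrow> reaches W P s 1 s'"
  by (auto simp: reaches_def intro!: exI[of _ 1])

lemma reaches_trans:
  assumes "reaches W P s T s'" "reaches W P s' T' s''" "T + T' \<le> U"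
  shows "reaches W P s U s''"
proof -
  obtain t t' where "t \<le> T" "(step W P ^^ t) s = s'" "t' \<le> T'" "(step W P ^^ t') s' = s''"
    using assms(1,2) by (auto simp: reaches_def)
  then have "(step W P ^^ (t' + t)) s = s''" by (simp add: funpow_add)
  then show ?thesis using \<open>t \<le> T\<close> \<open>t' \<le> T'\<close> assms(3)
    unfolding reaches_def by (intro exI[of _ "t' + t"]) auto
qed

lemma reaches_mono: "reaches W P s T s' \<Longrightarrow> T \<le> U \<Longrightarrow> reaches W P s U s'"
  unfolding reaches_def by (blast intro: order.trans)

fun occurs_at :: "instr list \<Rightarrow> nat \<Rightarrow> instr list \<Rightarrow> bool" where
  "occurs_at P l [] \<longleftrightarrow> True"
| "occurs_at P l (x # xs) \<longleftrightarrow> l < length P \<and> P ! l = x \<and> occurs_at P (Suc l) xs"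

lemma occurs_at_append [simp]:
  "occurs_at P l (xs @ ys) \<longleftrightarrow> occurs_at P l xs \<and> occurs_at P (l + length xs) ys"
  by (induction xs arbitrary: l) auto

lemma occurs_at_self: "occurs_at P 0 P"
proof -
  have "occurs_at (ys @ xs) (length ys) xs" for ys xs :: "instr list"
  proof (induction xs arbitrary: ys)
    case (Cons x xs)
    from Cons.IH[of "ys @ [x]"] show ?case by simp
  qed simp
  from this[of "[]" P] show ?thesis by simp
qed

lemma step_occurs_at:
  assumes "occurs_at P l [x]"
  shows "step W P (cfg l s) = exec_instr W x (cfg l s)"
  using assms by (auto simp: step_def halted_def cfg_def)

lemma reaches_step_occurs:
  assumes "occurs_at P l [x]" "exec_instr W x (cfg l s) = s'"
  shows "reaches W P (cfg l s) (Suc 0) s'"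
  using reaches_step[of W P "cfg l s" s'] assms by (simp add: step_occurs_at)

lemma code_correct:
  "occurs_at P l (code l b) \<Longrightarrow> reaches W P (cfg l s) (len b) (cfg (l + len b) (sem W b s))"
proof (induction b arbitrary: l s)
  case (Seq b c)
  then have "reaches W P (cfg l s) (len b) (cfg (l + len b) (sem W b s))"
    and "reaches W P (cfg (l + len b) (sem W b s)) (len c)
      (cfg (l + len b + len c) (sem W c (sem W b s)))"
    by (auto )
  then show ?case by (auto intro: reaches_trans simp: add.assoc)
next
  case (Cond i j b c)
  obtain r m where s: "s = (r, m)" by force
  have occ: "occurs_at P l [JumpLess i j (l + len c + 2)]" "occurs_at P (Suc l) (code (Suc l) c)"
    "occurs_at P (Suc l + len c) [Jump (l + len c + 2 + len b)]"
    "occurs_at P (l + len c + 2) (code (l + len c + 2) b)"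
    using Cond.prems
    by (auto simp: add.commute add.left_commute)
  show ?case
  proof (cases "r i < r j")
    case True
    then have "reaches W P (cfg l s) 1 (cfg (l + len c + 2) s)"
      using occ(1) by (intro reaches_step) (subst step_occurs_at, assumption, simp add: cfg_def s)
    from reaches_trans[OF this Cond.IH(1)[OF occ(4)] order.refl]
    have "reaches W P (cfg l s) (1 + len b) (cfg (l + len c + 2 + len b) (sem W b s))" .
    then show ?thesis using True
      by (auto simp: s add.commute add.left_commute elim: reaches_mono)
  next
    case False
    then have 1: "reaches W P (cfg l s) 1 (cfg (Suc l) s)"
      using occ(1) by (intro reaches_step) (subst step_occurs_at, assumption, simp add: cfg_def s)
    have 2: "reaches W P (cfg (Suc l + len c) (sem W c s)) 1 (cfg (l + len c + 2 + len b) (sem W c s))"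
      using occ(3) by (intro reaches_step) (subst step_occurs_at, assumption, simp add: cfg_def)
    from reaches_trans[OF reaches_trans[OF 1 Cond.IH(2)[OF occ(2)] order.refl] 2 order.refl]
    have "reaches W P (cfg l s) (1 + len c + 1) (cfg (l + len c + 2 + len b) (sem W c s))" .
    then show ?thesis using False
      by (auto simp: s add.commute add.left_commute elim: reaches_mono)
  qed
next
  case Skip
  then show ?case by (simp add: reaches_refl)
qed (simp, rule reaches_step_occurs, simp, simp add: cfg_def)+

section \<open>Phases: straight code and single loops\<close>

datatype phase = Straight blk | While nat nat blk

fun phase_len :: "phase \<Rightarrow> nat" where
  "phase_len (Straight b) = len b"
| "phase_len (While i j b) = len b + 3"

fun phase_code :: "nat \<Rightarrow> phase \<Rightarrow> instr list" where
  "phase_code l (Straight b) = code l b"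
| "phase_code l (While i j b) =
     JumpLess i j (l + 2) # Jump (l + len b + 3) # code (l + 2) b @ [Jump l]"

lemma length_phase_code [simp]: "length (phase_code l p) = phase_len p"
  by (cases p) auto

abbreviation less_test :: "nat \<Rightarrow> nat \<Rightarrow> store \<Rightarrow> bool" where
  "less_test i j s \<equiv> fst s i < fst s j"

fun outcome :: "nat \<Rightarrow> phase \<Rightarrow> store \<Rightarrow> nat \<Rightarrow> store \<Rightarrow> bool" where
  "outcome W (Straight b) s T s' \<longleftrightarrow> s' = sem W b s \<and> len b \<le> T"
| "outcome W (While i j b) s T s' \<longleftrightarrow>
     (\<exists>k. s' = (sem W b ^^ k) s \<and> (\<forall>k'<k. less_test i j ((sem W b ^^ k') s)) \<and>
          \<not> less_test i j s' \<and> k * (len b + 2) + 2 \<le> T)"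

text \<open>Every round pays for its body, the successful test and the jump back; the failing test
  and the exit jump account for the final 2.\<close>

lemma while_code_correct:
  assumes "occurs_at P l (phase_code l (While i j b))"
    and "\<forall>k'<k. less_test i j ((sem W b ^^ k') s)" "\<not> less_test i j ((sem W b ^^ k) s)"
  shows "reaches W P (cfg l s) (k * (len b + 2) + 2)
           (cfg (l + len b + 3) ((sem W b ^^ k) s))"
  using assms(2,3)
proof (induction k arbitrary: s)
  have occ: "occurs_at P l [JumpLess i j (l + 2)]" "occurs_at P (Suc l) [Jump (l + len b + 3)]"
    "occurs_at P (l + 2) (code (l + 2) b)" "occurs_at P (l + len b + 2) [Jump l]"
    using assms(1)
    by (auto simp: add.commute add.left_commute)
  {
    case 0
    have "reaches W P (cfg l s) 1 (cfg (Suc l) s)"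
      using occ(1) 0 by (intro reaches_step) (subst step_occurs_at, assumption, simp add: cfg_def)
    moreover have "reaches W P (cfg (Suc l) s) 1 (cfg (l + len b + 3) s)"
      using occ(2) by (intro reaches_step) (subst step_occurs_at, assumption, simp add: cfg_def)
    ultimately show ?case by (auto intro: reaches_trans)
  next
    case (Suc k)
    have "less_test i j s" using Suc.prems(1) by force
    then have 1: "reaches W P (cfg l s) 1 (cfg (l + 2) s)"
      using occ(1) by (intro reaches_step) (subst step_occurs_at, assumption, simp add: cfg_def)
    have 2: "reaches W P (cfg (l + 2 + len b) (sem W b s)) 1 (cfg l (sem W b s))"
      using occ(4) by (intro reaches_step) (simp add: step_occurs_at add.commute add.left_commute,
          simp add: cfg_def)
    have "\<forall>k'<k. less_test i j ((sem W b ^^ k') (sem W b s))"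
      using Suc.prems(1) by (metis Suc_less_eq comp_apply funpow_Suc_right)
    then have "reaches W P (cfg l (sem W b s)) (k * (len b + 2) + 2)
        (cfg (l + len b + 3) ((sem W b ^^ k) (sem W b s)))"
      using Suc.prems(2) by (intro Suc.IH) (simp_all add: funpow_swap1)
    from reaches_trans[OF reaches_trans[OF reaches_trans[OF 1 code_correct[OF occ(3)] order.refl] 2 order.refl]
        this order.refl]
    show ?case
      by (simp add: funpow_swap1 algebra_simps)
  }
qed

lemma phase_code_correct:
  assumes "occurs_at P l (phase_code l p)" "outcome W p s T s'"
  shows "reaches W P (cfg l s) T (cfg (l + phase_len p) s')"
proof (cases p)
  case (Straight b)
  then show ?thesis using assms reaches_mono[OF code_correct[of P l b W s]] by simp
next
  case (While i j b)
  then obtain k where "s' = (sem W b ^^ k) s" "\<forall>k'<k. less_test i j ((sem W b ^^ k') s)"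
    "\<not> less_test i j s'" and T: "k * (len b + 2) + 2 \<le> T"
    using assms(2) by auto
  then show ?thesis
    using while_code_correct[of P l i j b k W s] assms(1) While
    by (auto simp: add.assoc elim: reaches_mono)
qed

fun compile :: "nat \<Rightarrow> phase list \<Rightarrow> instr list" where
  "compile l [] = []"
| "compile l (p # ps) = phase_code l p @ compile (l + phase_len p) ps"

text \<open>A weakest precondition with a time budget: since \<open>Q\<close> speaks of the final
  store only, a program can be verified from its end backwards, each phase handing the remaining
  budget to the rest.\<close>

fun achieves :: "nat \<Rightarrow> phase list \<Rightarrow> store \<Rightarrow> nat \<Rightarrow> (store \<Rightarrow> bool) \<Rightarrow> bool" where
  "achieves W [] s T Q \<longleftrightarrow> Q s"
| "achieves W (p # ps) s T Q \<longleftrightarrow>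
     (\<exists>T1 T2 s'. T1 + T2 \<le> T \<and> outcome W p s T1 s' \<and> achieves W ps s' T2 Q)"

lemma compile_correct:
  assumes "occurs_at P l (compile l ps)" "achieves W ps s T Q"
  shows "\<exists>s'. reaches W P (cfg l s) T (cfg (l + length (compile l ps)) s') \<and> Q s'"
  using assms
proof (induction ps arbitrary: l s T)
  case Nil
  then show ?case using reaches_mono[OF reaches_refl le0] by (intro exI[of _ s]) simp
next
  case (Cons p ps)
  then obtain T1 T2 s1 where T: "T1 + T2 \<le> T" and 1: "outcome W p s T1 s1"
    and 2: "achieves W ps s1 T2 Q" by auto
  have occ: "occurs_at P l (phase_code l p)"
    "occurs_at P (l + phase_len p) (compile (l + phase_len p) ps)"
    using Cons.prems(1) by (simp_all add: occurs_at_append)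
  from Cons.IH[OF occ(2) 2] obtain s' where
    "reaches W P (cfg (l + phase_len p) s1) T2
       (cfg (l + phase_len p + length (compile (l + phase_len p) ps)) s')" "Q s'" by blast
  with reaches_trans[OF phase_code_correct[OF occ(1) 1] _ T] show ?case
    by (intro exI[of _ s']) (simp add: add.assoc)
qed

lemma compile_halts:
  assumes "achieves W ps (\<lambda>_. 0, mem (init_config xs)) T Q"
  shows "\<exists>s. halts_within W (compile 0 ps) xs T s \<and> Q (reg s, mem s)"
proof -
  from compile_correct[OF occurs_at_self assms] obtain s' where
    s': "reaches W (compile 0 ps) (cfg 0 (\<lambda>_. 0, mem (init_config xs))) T
       (cfg (length (compile 0 ps)) s')" "Q s'" by auto
  have "cfg 0 (\<lambda>_. 0, mem (init_config xs)) = init_config xs"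
    by (simp add: cfg_def init_config_def)
  then have "halts_within W (compile 0 ps) xs T (cfg (length (compile 0 ps)) s')"
    using s'(1) unfolding halts_within_def reaches_def by (auto simp: halted_def cfg_def)
  then show ?thesis using s'(2) by (intro exI[of _ "cfg (length (compile 0 ps)) s'"]) (simp add: cfg_def)
qed

lemma achieves_Straight:
  assumes "achieves W ps (sem W b s) T Q" "T + len b \<le> U"
  shows "achieves W (Straight b # ps) s U Q"
  unfolding achieves.simps
  by (rule exI[of _ "len b"], rule exI[of _ T]) (use assms in auto)

text \<open>The index of \<open>I\<close> joins invariant and variant: it decreases strictly in
  every round, so its initial value bounds the number of rounds.\<close>

lemma while_terminates:
  fixes I :: "nat \<Rightarrow> store \<Rightarrow> bool"
  assumes "I k s" "\<And>k s. I k s \<Longrightarrow> less_test i j s \<Longrightarrow> \<exists>k'<k. I k' (sem W b s)"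
  shows "\<exists>s' k'. outcome W (While i j b) s (k * (len b + 2) + 2) s' \<and> I k' s' \<and> \<not> less_test i j s'"
  using assms(1)
proof (induction k arbitrary: s rule: less_induct)
  case (less k)
  show ?case
  proof (cases "less_test i j s")
    case False
    then show ?thesis using less.prems by (intro exI[of _ s] exI[of _ k]) (auto intro!: exI[of _ 0])
  next
    case True
    then obtain k1 where k1: "k1 < k" "I k1 (sem W b s)" using assms(2)[OF less.prems] by blast
    from less.IH[OF this] obtain l k' where
      l: "\<forall>l'<l. less_test i j ((sem W b ^^ l') (sem W b s))"
      "\<not> less_test i j ((sem W b ^^ l) (sem W b s))" "I k' ((sem W b ^^ l) (sem W b s))"
      and T: "l * (len b + 2) + 2 \<le> k1 * (len b + 2) + 2"
      unfolding outcome.simps by blast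
    \<comment> \<open>The induction hypothesis bounds the rounds only through the running time;
      cancelling the cost of a round recovers the bound on their number.\<close>
    have "l \<le> k1" using T by (metis add_le_cancel_right mult_le_cancel2 zero_less_Suc add_2_eq_Suc')
    then have "Suc l * (len b + 2) \<le> k * (len b + 2)"
      using k1(1) by (intro mult_right_mono) auto
    moreover have "\<forall>l'<Suc l. less_test i j ((sem W b ^^ l') s)"
      using l(1) True by (auto simp: less_Suc_eq_0_disj funpow_swap1)
    ultimately show ?thesis
      using l(2,3) by (intro exI[of _ "(sem W b ^^ Suc l) s"] exI[of _ k'])
        (auto intro!: exI[of _ "Suc l"] simp: funpow_swap1)
  qed
qed

lemma achieves_While:
  fixes I :: "nat \<Rightarrow> store \<Rightarrow> bool"
  assumes "I k s" "\<And>k s. I k s \<Longrightarrow> less_test i j s \<Longrightarrow> \<exists>k'<k. I k' (sem W b s)"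
    and "\<And>k s'. I k s' \<Longrightarrow> \<not> less_test i j s' \<Longrightarrow> achieves W ps s' T Q"
    and "k * (len b + 2) + 2 + T \<le> U"
  shows "achieves W (While i j b # ps) s U Q"
proof -
  obtain s' where "outcome W (While i j b) s (k * (len b + 2) + 2) s'" "achieves W ps s' T Q"
    using while_terminates[of I k s i j W b, OF assms(1,2)] assms(3) by blast
  then show ?thesis using assms(4) unfolding achieves.simps by blast
qed

section \<open>Relabelling algorithm with unsplittable tokens\<close>

text \<open>
  A state consists of arrays indexed by vertices and of a stack. \<open>D\<close> holds the label of a vertex
  of \<open>A\<close>, and for a token \<open>b\<close> a lower bound of the labels of its neighbours;
  \<open>P\<close> is the current position in the adjacency list; \<open>Z\<close> holds the load of a vertex of \<open>A\<close> and
  the host of a token.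
\<close>

type_synonym state =
  "(nat \<Rightarrow> nat) \<times> (nat \<Rightarrow> nat) \<times> (nat \<Rightarrow> nat) \<times> (nat \<Rightarrow> nat) \<times> nat"

text \<open>Numbers below \<open>nA\<close> are hosts, the others tokens; \<open>tgt\<close> sends a
  position in an adjacency list to the vertex stored there. \<open>tgt_B\<close> contains the half
  of symmetry that matters: each neighbour of a token lists it, so a host that scans its own list
  meets all its tokens.\<close>

locale token_graph =
  fixes nA n q wB :: nat and wt start fin tgt :: "nat \<Rightarrow> nat"
  assumes nA_pos: "0 < nA" and nA_less: "nA < n"
    and wB_pos: "0 < wB" and wB_le: "wB \<le> q"
    and wt_le: "\<And>b. nA \<le> b \<Longrightarrow> b < n \<Longrightarrow> wt b \<le> wB"
    and start_le_fin: "\<And>v. v < n \<Longrightarrow> start v \<le> fin v"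
    and start_less_fin: "\<And>b. nA \<le> b \<Longrightarrow> b < n \<Longrightarrow> start b < fin b"
    and tgt_A: "\<And>a p. a < nA \<Longrightarrow> start a \<le> p \<Longrightarrow> p < fin a \<Longrightarrow> nA \<le> tgt p \<and> tgt p < n"
    and tgt_B: "\<And>b p. nA \<le> b \<Longrightarrow> b < n \<Longrightarrow> start b \<le> p \<Longrightarrow> p < fin b \<Longrightarrow>
      tgt p < nA \<and> (\<exists>p'. start (tgt p) \<le> p' \<and> p' < fin (tgt p) \<and> tgt p' = b)"
begin

text \<open>
  On a shortest path to a sink every vertex but the last hosts a token, so a vertex with a larger
  label than the number of tokens cannot reach a sink.
\<close>

definition top_label :: nat where
  "top_label = n - nA + 1"

definition load :: "(nat \<Rightarrow> nat) \<Rightarrow> nat \<Rightarrow> nat" where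
  "load Z a = wt a + (\<Sum>b | nA \<le> b \<and> b < n \<and> Z b = a. wt b)"

definition advance :: "state \<Rightarrow> state" where
  "advance = (\<lambda>(D, P, Z, S, sp). let a = S (sp - 1) in
     if q < Z a \<and> D a < top_label then
       if P a < fin a then
         let b = tgt (P a) in
         if Z b = a \<and> D b < D a then
           if P b < fin b then
             let c = tgt (P b) in
             if D b < D c then (D, P(b := P b + 1), Z, S, sp)
             else (D, P(a := P a + 1), Z(b := c, a := Z a - wt b, c := Z c + wt b),
                   S(sp := c), sp + 1)
           else (D(b := D b + 1), P(b := start b), Z, S, sp)
         else (D, P(a := P a + 1), Z, S, sp)
       else (D(a := D a + 1), P(a := start a), Z, S, sp)
     else (D, P, Z, S, sp - 1))"

text \<open>
  A relabelling resets a pointer, which the decrease of the first factor pays for; moving a token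
  advances the pointer of its old host by one, which pays for the new stack entry.
\<close>

definition potential :: "state \<Rightarrow> nat" where
  "potential = (\<lambda>(D, P, Z, S, sp).
     (\<Sum>v<n. (top_label - D v) * (2 * (fin v - start v) + 1) + 2 * (fin v - P v)) + sp)"

text \<open>A pointer at the end of its list has to certify a relabelling: whatever a token's
  pointer has passed lies strictly above the token, and whatever a host's pointer has passed is
  hosted elsewhere or has at least the label of the host. Both facts survive changes elsewhere,
  because labels only grow and an arriving token is never below its new host.\<close>

definition valid :: "state \<Rightarrow> bool" where
  "valid = (\<lambda>(D, P, Z, S, sp).
     (\<forall>i<sp. S i < nA) \<and>
     (\<forall>v<n. D v \<le> top_label \<and> start v \<le> P v \<and> P v \<le> fin v) \<and>
     (\<forall>b. nA \<le> b \<longrightarrow> b < n \<longrightarrow> (\<exists>p. start b \<le> p \<and> p < fin b \<and> Z b = tgt p)) \<and>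
     (\<forall>a<nA. Z a = load Z a) \<and>
     (\<forall>b p. nA \<le> b \<longrightarrow> b < n \<longrightarrow> start b \<le> p \<longrightarrow> p < fin b \<longrightarrow>
        D b \<le> D (tgt p) \<and> (p < P b \<longrightarrow> D b < D (tgt p))) \<and>
     (\<forall>a<nA. \<forall>p. start a \<le> p \<longrightarrow> p < P a \<longrightarrow> Z (tgt p) = a \<longrightarrow> D a \<le> D (tgt p)) \<and>
     (\<forall>b. nA \<le> b \<longrightarrow> b < n \<longrightarrow> D (Z b) \<le> D b + 1) \<and>
     (\<forall>a<nA. Z a + wB \<le> q \<longrightarrow> D a = 0) \<and>
     (\<forall>a<nA. q < Z a \<longrightarrow> D a = top_label \<or> (\<exists>i<sp. S i = a)))"

section \<open>Invariant and potential under one step\<close>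

lemma load_cong: "(\<And>b. nA \<le> b \<Longrightarrow> b < n \<Longrightarrow> Z b = Z' b) \<Longrightarrow> load Z a = load Z' a"
  unfolding load_def by (intro arg_cong2[of _ _ _ _ "(+)"] sum.cong) auto

lemma load_move:
  assumes "nA \<le> b" "b < n" "Z b = a" "c \<noteq> a"
  shows "load (Z(b := c)) a = load Z a - wt b" "wt b \<le> load Z a"
    "load (Z(b := c)) c = load Z c + wt b"
    "d \<noteq> a \<Longrightarrow> d \<noteq> c \<Longrightarrow> load (Z(b := c)) d = load Z d"
proof -
  have a: "{x. nA \<le> x \<and> x < n \<and> Z x = a} = insert b {x. nA \<le> x \<and> x < n \<and> (Z(b := c)) x = a}"
    and c: "{x. nA \<le> x \<and> x < n \<and> (Z(b := c)) x = c} = insert b {x. nA \<le> x \<and> x < n \<and> Z x = c}"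
    using assms by auto
  have "load Z a = load (Z(b := c)) a + wt b"
    unfolding load_def a using assms by (subst sum.insert) auto
  then show "load (Z(b := c)) a = load Z a - wt b" "wt b \<le> load Z a" by auto
  show "load (Z(b := c)) c = load Z c + wt b"
    unfolding load_def c using assms by (subst sum.insert) auto
  show "load (Z(b := c)) d = load Z d" if "d \<noteq> a" "d \<noteq> c"
    unfolding load_def using that assms
    by (intro arg_cong2[of _ _ _ _ "(+)"] sum.cong) auto
qed

lemma sum_decrease:
  fixes f g :: "nat \<Rightarrow> nat"
  assumes "v < n" "\<And>u. u < n \<Longrightarrow> u \<noteq> v \<Longrightarrow> g u = f u" "g v + k \<le> f v"
  shows "(\<Sum>u<n. g u) + k \<le> (\<Sum>u<n. f u)"
proof -
  have "(\<Sum>u<n. g u) = g v + (\<Sum>u\<in>{..<n} - {v}. g u)"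
    "(\<Sum>u<n. f u) = f v + (\<Sum>u\<in>{..<n} - {v}. f u)"
    using assms(1) by (auto intro: sum.remove)
  moreover have "(\<Sum>u\<in>{..<n} - {v}. g u) = (\<Sum>u\<in>{..<n} - {v}. f u)"
    using assms(2) by (intro sum.cong) auto
  ultimately show ?thesis using assms(3) by simp
qed

lemma relabel_decrease:
  fixes d s e p :: nat
  assumes "d < top_label" "s \<le> e" "e \<le> p"
  shows "(top_label - (d + 1)) * (2 * (e - s) + 1) + 2 * (e - s) + 1
    \<le> (top_label - d) * (2 * (e - s) + 1) + 2 * (e - p)"
proof -
  obtain k where "top_label - d = Suc k" "top_label - (d + 1) = k"
    using assms by (metis Suc_diff_Suc Suc_eq_plus1)
  then show ?thesis by simp
qed

lemma advance_valid:
  assumes "valid (D, P, Z, S, sp)" "0 < sp"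
  shows "valid (advance (D, P, Z, S, sp)) \<and>
    potential (advance (D, P, Z, S, sp)) < potential (D, P, Z, S, sp)"
proof -
  define a where "a = S (sp - 1)"
  define b where "b = tgt (P a)"
  define c where "c = tgt (P b)"
  have v1: "\<And>i. i < sp \<Longrightarrow> S i < nA"
    and v2: "\<And>v. v < n \<Longrightarrow> D v \<le> top_label" "\<And>v. v < n \<Longrightarrow> start v \<le> P v" "\<And>v. v < n \<Longrightarrow> P v \<le> fin v"
    and v3: "\<And>b. nA \<le> b \<Longrightarrow> b < n \<Longrightarrow> \<exists>p. start b \<le> p \<and> p < fin b \<and> Z b = tgt p"
    and v4: "\<And>a. a < nA \<Longrightarrow> Z a = load Z a"
    and v5: "\<And>b p. nA \<le> b \<Longrightarrow> b < n \<Longrightarrow> start b \<le> p \<Longrightarrow> p < fin b \<Longrightarrow> D b \<le> D (tgt p)"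
      "\<And>b p. nA \<le> b \<Longrightarrow> b < n \<Longrightarrow> start b \<le> p \<Longrightarrow> p < fin b \<Longrightarrow> p < P b \<Longrightarrow> D b < D (tgt p)"
    and v6: "\<And>a p. a < nA \<Longrightarrow> start a \<le> p \<Longrightarrow> p < P a \<Longrightarrow> Z (tgt p) = a \<Longrightarrow> D a \<le> D (tgt p)"
    and v7: "\<And>b. nA \<le> b \<Longrightarrow> b < n \<Longrightarrow> D (Z b) \<le> D b + 1"
    and v8: "\<And>a. a < nA \<Longrightarrow> Z a + wB \<le> q \<Longrightarrow> D a = 0"
    and v9: "\<And>a. a < nA \<Longrightarrow> q < Z a \<Longrightarrow> D a = top_label \<or> (\<exists>i<sp. S i = a)"
    using assms(1) unfolding valid_def by auto
  have host: "Z x < nA" if "nA \<le> x" "x < n" for x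
    using v3[OF that] tgt_B that by metis
  have a: "a < nA" using v1 assms(2) by (auto simp: a_def)
  then have "a < n" using nA_less by simp
  note a = a this
  have on_stack: "\<exists>i<sp. S i = a" using assms(2) by (auto simp: a_def intro!: exI[of _ "sp - 1"])
  consider (pop) "\<not> (q < Z a \<and> D a < top_label)"
    | (relabel) "q < Z a" "D a < top_label" "fin a \<le> P a"
    | (skip) "q < Z a" "D a < top_label" "P a < fin a" "\<not> (Z b = a \<and> D b < D a)"
    | (level) "q < Z a" "D a < top_label" "P a < fin a" "Z b = a" "D b < D a" "fin b \<le> P b"
    | (scan) "q < Z a" "D a < top_label" "P a < fin a" "Z b = a" "D b < D a" "P b < fin b" "D b < D c"
    | (move) "q < Z a" "D a < top_label" "P a < fin a" "Z b = a" "D b < D a" "P b < fin b" "D c \<le> D b"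
    by linarith
  then show ?thesis
  proof cases
    case pop
    then have adv: "advance (D, P, Z, S, sp) = (D, P, Z, S, sp - 1)"
      by (auto simp: advance_def a_def Let_def)
    \<comment> \<open>Only an entry of \<open>a\<close> disappears, and \<open>a\<close> is inactive
      or already at the top label.\<close>
    have "D x = top_label \<or> (\<exists>i<sp - 1. S i = x)" if "x < nA" "q < Z x" for x
    proof (cases "x = a")
      case True
      then show ?thesis using pop that v2(1)[of a] a by auto
    next
      case False
      with v9[OF that] show ?thesis
        by (metis One_nat_def Suc_pred a_def assms(2) less_SucE)
    qed
    then have "valid (D, P, Z, S, sp - 1)"
      using assms(1) unfolding valid_def by auto
    then show ?thesis using assms(2) by (simp add: adv potential_def)
  next
    case relabel
    then have adv: "advance (D, P, Z, S, sp) = (D(a := D a + 1), P(a := start a), Z, S, sp)"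
      by (auto simp: advance_def a_def Let_def)
    have Pa: "P a = fin a" using relabel v2(3) a by (simp add: le_antisym)
    \<comment> \<open>The pointer has passed the whole list, which contains every token of
      \<open>a\<close> by \<open>tgt_B\<close>. So no token of \<open>a\<close> is below
      \<open>a\<close>, and raising \<open>a\<close> by one leaves it at most one above its
      tokens.\<close>
    have la: "D a \<le> D x" if x: "nA \<le> x" "x < n" "Z x = a" for x
    proof -
      obtain p' where "start a \<le> p'" "p' < fin a" "tgt p' = x"
        using v3[OF x(1,2)] tgt_B x by metis
      then show ?thesis using v6[of a p'] a Pa x by auto
    qed
    have "valid (D(a := D a + 1), P(a := start a), Z, S, sp)"
      unfolding valid_def prod.case
    proof (intro conjI allI impI)
      fix x p assume x: "nA \<le> x" "x < n" "start x \<le> p" "p < fin x"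
      then show "(D(a := D a + 1)) x \<le> (D(a := D a + 1)) (tgt p)"
        using a v5(1)[OF x] by auto
      assume "p < (P(a := start a)) x"
      then show "(D(a := D a + 1)) x < (D(a := D a + 1)) (tgt p)"
        using a x v5(2)[OF x] by auto
    next
      fix x p assume x: "x < nA" "start x \<le> p" "p < (P(a := start a)) x" "Z (tgt p) = x"
      then have "x \<noteq> a" by auto
      then have "D x \<le> D (tgt p)" using v6[of x p] x by auto
      then show "(D(a := D a + 1)) x \<le> (D(a := D a + 1)) (tgt p)"
        using \<open>x \<noteq> a\<close> by auto
    next
      fix x assume x: "nA \<le> x" "x < n"
      then show "(D(a := D a + 1)) (Z x) \<le> (D(a := D a + 1)) x + 1"
        using v7[OF x] la[OF x] a by auto
    next
      fix x assume "x < nA" "Z x + wB \<le> q"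
      then show "(D(a := D a + 1)) x = 0" using v8[of x] relabel by auto
    next
      fix x assume "x < nA" "q < Z x"
      then show "(D(a := D a + 1)) x = top_label \<or> (\<exists>i<sp. S i = x)"
        using v9[of x] on_stack by (cases "x = a") auto
    qed (use v1 v2 v3 v4 relabel a start_le_fin in \<open>auto\<close>)
    moreover have "(\<Sum>v<n. (top_label - (D(a := D a + 1)) v) * (2 * (fin v - start v) + 1)
          + 2 * (fin v - (P(a := start a)) v)) + 1
        \<le> (\<Sum>v<n. (top_label - D v) * (2 * (fin v - start v) + 1) + 2 * (fin v - P v))"
      using relabel_decrease[OF relabel(2) start_le_fin[OF a(2)] relabel(3)]
      by (intro sum_decrease[OF a(2)]) auto
    ultimately show ?thesis by (simp add: adv potential_def)
  next
    case skip
    then have adv: "advance (D, P, Z, S, sp) = (D, P(a := P a + 1), Z, S, sp)"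
      by (auto simp: advance_def a_def b_def Let_def)
    have "valid (D, P(a := P a + 1), Z, S, sp)"
      unfolding valid_def prod.case
    proof (intro conjI allI impI)
      fix x p assume x: "x < nA" "start x \<le> p" "p < (P(a := P a + 1)) x" "Z (tgt p) = x"
      show "D x \<le> D (tgt p)"
      proof (cases "x = a \<and> p = P a")
        case True
        then show ?thesis using skip x by (auto simp: b_def)
      next
        case False
        then show ?thesis using v6[of x p] x by (auto split: if_splits)
      qed
    qed (use v1 v2 v3 v4 v5 v7 v8 v9 a skip in \<open>auto intro: le_SucI\<close>)
    moreover have "(\<Sum>v<n. (top_label - D v) * (2 * (fin v - start v) + 1)
          + 2 * (fin v - (P(a := P a + 1)) v)) + 2
        \<le> (\<Sum>v<n. (top_label - D v) * (2 * (fin v - start v) + 1) + 2 * (fin v - P v))"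
      using skip by (intro sum_decrease[OF a(2)]) auto
    ultimately show ?thesis by (simp add: adv potential_def)
  next
    case level
    then have adv: "advance (D, P, Z, S, sp) = (D(b := D b + 1), P(b := start b), Z, S, sp)"
      by (auto simp: advance_def a_def b_def Let_def)
    have b: "nA \<le> b" "b < n" "b \<noteq> a"
      using tgt_A[of a "P a"] a v2 level by (auto simp: b_def)
    have Pb: "P b = fin b" using level v2(3) b by (simp add: le_antisym)
    have "valid (D(b := D b + 1), P(b := start b), Z, S, sp)"
      unfolding valid_def prod.case
    proof (intro conjI allI impI)
      fix x p assume x: "nA \<le> x" "x < n" "start x \<le> p" "p < fin x"
      then have t: "tgt p < nA" using tgt_B by auto
      \<comment> \<open>The exhausted list puts all neighbours of \<open>b\<close> strictly above
        its old label, so the raised label is still a lower bound for theirs.\<close>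
      show "(D(b := D b + 1)) x \<le> (D(b := D b + 1)) (tgt p)"
        using b t v5(1)[OF x] v5(2)[OF x] x Pb by (auto simp: Suc_le_eq)
      assume "p < (P(b := start b)) x"
      then show "(D(b := D b + 1)) x < (D(b := D b + 1)) (tgt p)"
        using b t x v5(2)[OF x] by (auto split: if_splits)
    next
      fix x p assume x: "x < nA" "start x \<le> p" "p < (P(b := start b)) x" "Z (tgt p) = x"
      then have "x \<noteq> b" using b by auto
      then have "D x \<le> D (tgt p)" using v6[of x p] x by auto
      then show "(D(b := D b + 1)) x \<le> (D(b := D b + 1)) (tgt p)"
        using \<open>x \<noteq> b\<close> by auto
    next
      fix x assume x: "nA \<le> x" "x < n"
      then show "(D(b := D b + 1)) (Z x) \<le> (D(b := D b + 1)) x + 1"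
        using v7[OF x] host[OF x] b by auto
    next
      fix x assume "x < nA" "Z x + wB \<le> q"
      then show "(D(b := D b + 1)) x = 0" using v8[of x] b by auto
    next
      fix x assume "x < nA" "q < Z x"
      then show "(D(b := D b + 1)) x = top_label \<or> (\<exists>i<sp. S i = x)"
        using v9[of x] b by auto
    qed (use v1 v2 v3 v4 level b start_le_fin in \<open>auto\<close>)
    moreover have "(\<Sum>v<n. (top_label - (D(b := D b + 1)) v) * (2 * (fin v - start v) + 1)
          + 2 * (fin v - (P(b := start b)) v)) + 1
        \<le> (\<Sum>v<n. (top_label - D v) * (2 * (fin v - start v) + 1) + 2 * (fin v - P v))"
      using relabel_decrease[OF _ start_le_fin[OF b(2)] level(6), of "D b"] level(2,5)
      by (intro sum_decrease[OF b(2)]) auto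
    ultimately show ?thesis by (simp add: adv potential_def)
  next
    case scan
    then have adv: "advance (D, P, Z, S, sp) = (D, P(b := P b + 1), Z, S, sp)"
      by (auto simp: advance_def a_def b_def c_def Let_def)
    have b: "nA \<le> b" "b < n" "b \<noteq> a"
      using tgt_A[of a "P a"] a v2 scan by (auto simp: b_def)
    have "valid (D, P(b := P b + 1), Z, S, sp)"
      unfolding valid_def prod.case
    proof (intro conjI allI impI)
      fix x p assume x: "nA \<le> x" "x < n" "start x \<le> p" "p < fin x" "p < (P(b := P b + 1)) x"
      show "D x < D (tgt p)"
      proof (cases "x = b \<and> p = P b")
        case True
        then show ?thesis using scan by (auto simp: c_def)
      next
        case False
        then show ?thesis using v5(2)[of x p] x by (auto split: if_splits)
      qed
    next
      fix x p assume x: "x < nA" "start x \<le> p" "p < (P(b := P b + 1)) x" "Z (tgt p) = x"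
      then show "D x \<le> D (tgt p)" using v6[of x p] b by auto
    qed (use v1 v2 v3 v4 v5(1) v7 v8 v9 b scan in \<open>auto intro: le_SucI\<close>)
    moreover have "(\<Sum>v<n. (top_label - D v) * (2 * (fin v - start v) + 1)
          + 2 * (fin v - (P(b := P b + 1)) v)) + 2
        \<le> (\<Sum>v<n. (top_label - D v) * (2 * (fin v - start v) + 1) + 2 * (fin v - P v))"
      using scan by (intro sum_decrease[OF b(2)]) auto
    ultimately show ?thesis by (simp add: adv potential_def)
  next
    case move
    define Z' where "Z' = Z(b := c, a := Z a - wt b, c := Z c + wt b)"
    from move have adv: "advance (D, P, Z, S, sp) = (D, P(a := P a + 1), Z', S(sp := c), sp + 1)"
      by (auto simp: advance_def a_def b_def c_def Let_def Z'_def)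
    have b: "nA \<le> b" "b < n" "b \<noteq> a"
      using tgt_A[of a "P a"] a v2 move by (auto simp: b_def)
    have c: "c < nA" using tgt_B[of b "P b"] b v2 move by (auto simp: c_def)
    have "c \<noteq> a" using move by auto
    have Z': "Z' b = c" "Z' a = Z a - wt b" "Z' c = Z c + wt b"
      "\<And>x. x \<noteq> a \<Longrightarrow> x \<noteq> b \<Longrightarrow> x \<noteq> c \<Longrightarrow> Z' x = Z x"
      using b c \<open>c \<noteq> a\<close> by (auto simp: Z'_def)
    have ZB: "Z' x = (Z(b := c)) x" if "nA \<le> x" for x
      using that a c by (auto simp: Z'_def)
    note mv = load_move[where Z=Z, OF b(1,2) move(4) \<open>c \<noteq> a\<close>]
    have "wt b \<le> wB" using wt_le b by auto
    have "valid (D, P(a := P a + 1), Z', S(sp := c), sp + 1)"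
      unfolding valid_def prod.case
    proof (intro conjI allI impI)
      fix x assume x: "nA \<le> x" "x < n"
      show "\<exists>p. start x \<le> p \<and> p < fin x \<and> Z' x = tgt p"
        using v3[OF x] ZB[OF x(1)] v2 move b by (cases "x = b") (auto simp: c_def)
      show "D (Z' x) \<le> D x + 1"
        using v7[OF x] ZB[OF x(1)] move by auto
    next
      fix x assume x: "x < nA"
      have "load Z' x = load (Z(b := c)) x" by (rule load_cong) (auto simp: ZB)
      then show "Z' x = load Z' x"
        using mv(1,3) mv(4)[of x] v4[OF x] Z' x b by (cases "x = a"; cases "x = c") auto
    next
      fix x p assume x: "x < nA" "start x \<le> p" "p < (P(a := P a + 1)) x" "Z' (tgt p) = x"
      have "P x \<le> fin x" using x(1) nA_less v2(3) by simp
      then have "p < fin x" using x(3) move(3) by (cases "x = a") auto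
      then have t: "nA \<le> tgt p" using tgt_A x by auto
      show "D x \<le> D (tgt p)"
      proof (cases "tgt p = b")
        case True
        \<comment> \<open>The moved token now belongs to \<open>c\<close>, and
          \<open>D c \<le> D b\<close> makes it harmless wherever the pointer of \<open>c\<close>
          stands.\<close>
        then show ?thesis using x Z' move by auto
      next
        case False
        then have "Z (tgt p) = x" using x ZB[OF t] by auto
        moreover have "\<not> (x = a \<and> p = P a)" using False b_def by auto
        ultimately show ?thesis using v6[of x p] x by (auto split: if_splits)
      qed
    next
      fix x assume x: "x < nA" "Z' x + wB \<le> q"
      then show "D x = 0"
        using v8[of x] Z' \<open>wt b \<le> wB\<close> move(1) b
        by (cases "x = a"; cases "x = c") auto
    next
      fix x assume x: "x < nA" "q < Z' x"
      then show "D x = top_label \<or> (\<exists>i<sp + 1. (S(sp := c)) i = x)"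
      proof (cases "x = c")
        case False
        have "D x = top_label \<or> (\<exists>i<sp. S i = x)"
        proof (cases "x = a")
          case False
          then have "Z' x = Z x" using Z'(4) \<open>x \<noteq> c\<close> x b by auto
          then show ?thesis using v9[of x] x by auto
        qed (use on_stack in auto)
        then show ?thesis by (metis fun_upd_other less_add_one less_trans nat_neq_iff)
      qed (auto intro!: exI[of _ sp])
    next
      fix i assume "i < sp + 1"
      then show "(S(sp := c)) i < nA" using v1[of i] c by auto
    next
      fix v assume "v < n"
      then show "D v \<le> top_label" "start v \<le> (P(a := P a + 1)) v" "(P(a := P a + 1)) v \<le> fin v"
        using v2[of v] move(3) by auto
    qed (use v5 a(1) in \<open>auto split: if_splits\<close>)
    moreover have "(\<Sum>v<n. (top_label - D v) * (2 * (fin v - start v) + 1)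
          + 2 * (fin v - (P(a := P a + 1)) v)) + 2
        \<le> (\<Sum>v<n. (top_label - D v) * (2 * (fin v - start v) + 1) + 2 * (fin v - P v))"
      using move by (intro sum_decrease[OF a(2)]) auto
    ultimately show ?thesis by (simp add: adv potential_def)
  qed
qed

text \<open>With all labels 0 and all pointers at their starts, the conditions on labels hold
  trivially; stacking all of A covers every active vertex.\<close>

lemma valid_init:
  assumes "\<And>v. v < n \<Longrightarrow> P v = start v" "\<And>b. nA \<le> b \<Longrightarrow> b < n \<Longrightarrow> Z b = tgt (start b)"
    and "\<And>a. a < nA \<Longrightarrow> Z a = load Z a" "\<And>a. a < nA \<Longrightarrow> S a = a"
  shows "valid (\<lambda>_. 0, P, Z, S, nA)"
    and "potential (\<lambda>_. 0, P, Z, S, nA) =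
      top_label * (2 * (\<Sum>v<n. fin v - start v) + n) + 2 * (\<Sum>v<n. fin v - start v) + nA"
proof -
  show "valid (\<lambda>_. 0, P, Z, S, nA)"
    using assms start_less_fin start_le_fin nA_less unfolding valid_def by auto
  have "(\<Sum>v<n. (top_label - 0) * (2 * (fin v - start v) + 1) + 2 * (fin v - P v)) =
      (\<Sum>v<n. top_label * (2 * (fin v - start v) + 1) + 2 * (fin v - start v))"
    using assms(1) by (intro sum.cong) auto
  also have "\<dots> = top_label * (2 * (\<Sum>v<n. fin v - start v) + n) + 2 * (\<Sum>v<n. fin v - start v)"
    by (simp add: sum.distrib sum_distrib_left[symmetric] distrib_left add_ac mult.commute[of n])
  finally show "potential (\<lambda>_. 0, P, Z, S, nA) =
      top_label * (2 * (\<Sum>v<n. fin v - start v) + n) + 2 * (\<Sum>v<n. fin v - start v) + nA"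
    by (simp add: potential_def)
qed

section \<open>Reading the partition off the labels\<close>

text \<open>
  No token lives at level \<open>k > 0\<close>, hence the hosts with label at least \<open>k\<close> have tokens all of
  whose neighbours have label at least \<open>k\<close>; \<open>k = 0\<close> is chosen exactly if there is no sink.
\<close>

definition is_threshold :: "(nat \<Rightarrow> nat) \<Rightarrow> (nat \<Rightarrow> nat) \<Rightarrow> nat \<Rightarrow> bool" where
  "is_threshold D Z k \<longleftrightarrow>
     (k = 0 \<longleftrightarrow> (\<forall>a<nA. q < Z a + wB)) \<and>
     (0 < k \<longrightarrow> (\<forall>b. nA \<le> b \<longrightarrow> b < n \<longrightarrow> D (Z b) \<noteq> k)) \<and> k \<le> top_label"

text \<open>Pigeonhole over the tokens; with one level fewer, all levels could be occupied.\<close>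

lemma free_level_exists:
  "\<exists>k. 0 < k \<and> k \<le> top_label \<and> (\<forall>b. nA \<le> b \<longrightarrow> b < n \<longrightarrow> g b \<noteq> k)"
proof (rule ccontr)
  assume "\<not> ?thesis"
  then have "{1..top_label} \<subseteq> g ` {nA..<n}" by fastforce
  then have "card {1..top_label} \<le> card (g ` {nA..<n})" by (intro card_mono) auto
  also have "\<dots> \<le> card {nA..<n}" by (rule card_image_le) simp
  finally show False by (simp add: top_label_def)
qed

text \<open>For \<open>k > 0\<close>, a vertex with label at least \<open>k\<close> is no sink
  because sinks have label 0; for \<open>k = 0\<close> there are no sinks at all. A vertex with
  label below \<open>k\<close> is below the top label, so with an empty stack it cannot be
  active.\<close>

lemma valid_final:
  assumes "valid (D, P, Z, S, 0)" "is_threshold D Z k"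
  shows "a < nA \<Longrightarrow> k \<le> D a \<Longrightarrow> q < load Z a + wB"
    and "a < nA \<Longrightarrow> D a < k \<Longrightarrow> load Z a \<le> q"
    and "nA \<le> b \<Longrightarrow> b < n \<Longrightarrow> k \<le> D (Z b) \<Longrightarrow> start b \<le> p \<Longrightarrow> p < fin b \<Longrightarrow> k \<le> D (tgt p)"
    and "q * nA \<le> (\<Sum>v<n. wt v) \<Longrightarrow> \<exists>a<nA. k \<le> D a"
proof -
  have k: "k = 0 \<longleftrightarrow> (\<forall>a<nA. q < Z a + wB)" "k \<le> top_label"
    "\<And>b. 0 < k \<Longrightarrow> nA \<le> b \<Longrightarrow> b < n \<Longrightarrow> D (Z b) \<noteq> k"
    using assms(2) by (auto simp: is_threshold_def)
  have v3: "\<And>b. nA \<le> b \<Longrightarrow> b < n \<Longrightarrow> \<exists>p. start b \<le> p \<and> p < fin b \<and> Z b = tgt p"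
    and v4: "\<And>a. a < nA \<Longrightarrow> Z a = load Z a"
    and v5: "\<And>b p. nA \<le> b \<Longrightarrow> b < n \<Longrightarrow> start b \<le> p \<Longrightarrow> p < fin b \<Longrightarrow> D b \<le> D (tgt p)"
    and v7: "\<And>b. nA \<le> b \<Longrightarrow> b < n \<Longrightarrow> D (Z b) \<le> D b + 1"
    and v8: "\<And>a. a < nA \<Longrightarrow> Z a + wB \<le> q \<Longrightarrow> D a = 0"
    and v9: "\<And>a. a < nA \<Longrightarrow> q < Z a \<Longrightarrow> D a = top_label"
    using assms(1) unfolding valid_def by auto
  have host: "Z x < nA" if "nA \<le> x" "x < n" for x
    using v3[OF that] tgt_B that by metis
  show "q < load Z a + wB" if "a < nA" "k \<le> D a" for a
    using that v4 v8 k(1) by (metis le_zero_eq not_le)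
  show low: "load Z a \<le> q" if "a < nA" "D a < k" for a
    using that v4 v9 k(2) by (metis not_le)
  show "k \<le> D (tgt p)" if "nA \<le> b" "b < n" "k \<le> D (Z b)" "start b \<le> p" "p < fin b" for b p
  proof (cases "k = 0")
    case False
    then have "k < D (Z b)" using k(3)[OF _ that(1,2)] that(3) by auto
    then show ?thesis using v7[OF that(1,2)] v5[OF that(1,2,4,5)] by simp
  qed simp
  assume total: "q * nA \<le> (\<Sum>v<n. wt v)"
  show "\<exists>a<nA. k \<le> D a"
  proof (rule ccontr)
    assume "\<not> ?thesis"
    then have less: "\<And>a. a < nA \<Longrightarrow> D a < k" by (auto simp: not_le)
    have "(\<Sum>a<nA. load Z a) = (\<Sum>a<nA. wt a) + (\<Sum>b\<in>{nA..<n}. wt b)"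
    proof -
      have "(\<Sum>a<nA. \<Sum>b | nA \<le> b \<and> b < n \<and> Z b = a. wt b) = (\<Sum>a<nA. \<Sum>b | b \<in> {nA..<n} \<and> Z b = a. wt b)"
        by (intro sum.cong) auto
      also have "\<dots> = (\<Sum>b\<in>{nA..<n}. wt b)"
        by (intro sum.group) (use host in auto)
      finally show ?thesis by (simp add: load_def sum.distrib)
    qed
    also have "\<dots> = (\<Sum>v<n. wt v)"
      using sum.atLeastLessThan_concat[of 0 nA n wt] nA_less by (simp add: atLeast0LessThan)
    finally have sum: "q * nA \<le> (\<Sum>a<nA. load Z a)" using total by simp
    \<comment> \<open>Some vertex exists by \<open>nA_pos\<close> and has label below
      \<open>k\<close>; so \<open>k\<close> is positive, which means that there is a sink. Its load
      is strictly below \<open>q\<close>.\<close>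
    obtain s where s: "s < nA" "Z s + wB \<le> q"
      using less[OF nA_pos] k(1) by (metis gr_implies_not0 not_le)
    have "(\<Sum>a<nA. load Z a) < (\<Sum>a<nA. q)"
      using s v4[OF s(1)] wB_pos low less by (intro sum_strict_mono_ex1) (auto intro!: bexI[of _ s])
    then show False using sum by (simp add: mult.commute)
  qed
qed

end

section \<open>The program\<close>

text \<open>
  Register usage: 0 = \<open>nA\<close>, 1 = \<open>n\<close>, 2 = \<open>q\<close>, 3 = maximal token weight, 4 = offset table,
  5 = adjacency lists, 6 to 10 = bases of the arrays \<open>D\<close>, \<open>P\<close>, \<open>Z\<close>, \<open>K\<close> (level marks) and
  \<open>S\<close> (stack), 11 = stack pointer, 12 = top label, 13 = constant 1, 14 = loop counter,
  15 = address 3 of the weights, 16 = constant 0, 18 = threshold in the final phases; the others are temporary.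
\<close>

definition header_block :: blk where
  "header_block =
     SetC 13 1 ;; SetC 15 3 ;; SetC 17 0 ;; Get 0 17 ;; Get 17 13 ;; Op Add 1 0 17 ;;
     Op Add 12 17 13 ;; SetC 17 2 ;; Get 2 17 ;; Op Add 4 15 1 ;; Op Add 5 4 1 ;; Get 17 5 ;;
     Op Add 5 5 13 ;; Op Add 6 5 17 ;; Op Add 7 6 1 ;; Op Add 8 7 1 ;; Op Add 9 8 1 ;;
     Op Add 10 9 1 ;; Op Add 10 10 13"

definition init_A_block :: blk where
  "init_A_block =
     Op Add 17 4 14 ;; Get 17 17 ;; Op Add 17 5 17 ;; Op Add 18 7 14 ;; Put 18 17 ;;
     Op Add 18 15 14 ;; Get 17 18 ;; Op Add 18 8 14 ;; Put 18 17 ;;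
     Op Add 18 10 14 ;; Put 18 14 ;; Op Add 14 14 13"

text \<open>A token is first hosted by the head of its adjacency list. Register 3 collects the
  maximal token weight; adding register 16 amounts to copying.\<close>

definition init_B_block :: blk where
  "init_B_block =
     Op Add 17 4 14 ;; Get 17 17 ;; Op Add 17 5 17 ;; Op Add 18 7 14 ;; Put 18 17 ;;
     Get 19 17 ;; Op Add 18 8 14 ;; Put 18 19 ;; Op Add 18 15 14 ;; Get 20 18 ;;
     Op Add 18 8 19 ;; Get 21 18 ;; Op Add 21 21 20 ;; Put 18 21 ;;
     Cond 3 20 (Op Add 3 20 16) Skip ;; Op Add 14 14 13"

definition skip_block :: blk where
  "skip_block = Op Add 23 23 13 ;; Put 22 23"

definition move_block :: blk where
  "move_block =
     skip_block ;; Put 26 31 ;; Op Add 33 15 25 ;; Get 33 33 ;; Op Sub 19 19 33 ;; Put 18 19 ;;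
     Op Add 34 8 31 ;; Get 35 34 ;; Op Add 35 35 33 ;; Put 34 35 ;;
     Op Add 34 10 11 ;; Put 34 31 ;; Op Add 11 11 13"

definition token_block :: blk where
  "token_block =
     Op Add 24 7 25 ;; Get 30 24 ;; Op Add 31 4 25 ;; Op Add 31 31 13 ;; Get 31 31 ;;
     Op Add 31 5 31 ;;
     Cond 30 31
       (Get 31 30 ;; Op Add 32 6 31 ;; Get 32 32 ;;
        Cond 29 32 (Op Add 30 30 13 ;; Put 24 30) move_block)
       (Op Add 29 29 13 ;; Put 28 29 ;; Op Add 31 4 25 ;; Get 31 31 ;; Op Add 31 5 31 ;;
        Put 24 31)"

text \<open>The machine only compares strictly, so the equality of \<open>Z b\<close> and
  \<open>a\<close> takes two tests; this explains the repeated \<open>skip_block\<close>.\<close>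

definition advance_block :: blk where
  "advance_block =
     Op Sub 17 11 13 ;; Op Add 17 10 17 ;; Get 17 17 ;; Op Add 18 8 17 ;; Get 19 18 ;;
     Op Add 20 6 17 ;; Get 21 20 ;;
     Cond 2 19
       (Cond 21 12
         (Op Add 22 7 17 ;; Get 23 22 ;; Op Add 24 4 17 ;; Op Add 24 24 13 ;; Get 24 24 ;;
          Op Add 24 5 24 ;;
          Cond 23 24
            (Get 25 23 ;; Op Add 26 8 25 ;; Get 27 26 ;; Op Add 28 6 25 ;; Get 29 28 ;;
             Cond 27 17 skip_block
               (Cond 17 27 skip_block (Cond 29 21 token_block skip_block)))
            (Op Add 21 21 13 ;; Put 20 21 ;; Op Add 24 4 17 ;; Get 24 24 ;; Op Add 24 5 24 ;;
             Put 22 24))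
         (Op Sub 11 11 13))
       (Op Sub 11 11 13)"

definition mark_block :: blk where
  "mark_block =
     Op Add 17 8 14 ;; Get 17 17 ;; Op Add 17 6 17 ;; Get 17 17 ;; Op Add 17 9 17 ;;
     Put 17 13 ;; Op Add 14 14 13"

text \<open>Cell 0 of \<open>K\<close> is given a new meaning: it becomes 1 if a sink exists. One
  search for the first 0 in \<open>K\<close> then yields a threshold in both cases, 0 without sinks
  and a free positive level otherwise.\<close>

definition sink_block :: blk where
  "sink_block =
     Op Add 17 8 14 ;; Get 17 17 ;; Op Add 17 17 3 ;; Cond 2 17 Skip (Put 9 13) ;;
     Op Add 14 14 13"

definition search_block :: blk where
  "search_block = Op Add 18 18 13 ;; Op Add 17 9 18 ;; Get 17 17"

text \<open>The result overwrites the first \<open>n\<close> cells of the input, which is safe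
  because only \<open>D\<close> and \<open>Z\<close> are still read.\<close>

definition output_block :: blk where
  "output_block =
     Cond 14 0
       (Op Add 17 6 14 ;; Get 17 17 ;; Cond 17 18 (Put 14 16) (Put 14 13))
       (Op Add 17 8 14 ;; Get 17 17 ;; Put 14 17) ;;
     Op Add 14 14 13"

definition expansion_phases :: "phase list" where
  "expansion_phases =
     [Straight header_block,
      While 14 0 init_A_block,
      Straight (Op Add 11 0 16),
      While 14 1 init_B_block,
      While 16 11 advance_block,
      Straight (Op Add 14 0 16),
      While 14 1 mark_block,
      Straight (Put 9 16 ;; SetC 14 0),
      While 14 0 sink_block,
      Straight (SetC 18 0 ;; Get 17 9),
      While 16 17 search_block,
      Straight (SetC 14 0),
      While 14 1 output_block]"

text \<open>\<open>start\<close> and \<open>fin\<close> are absolute addresses, so a pointer is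
  followed by a single load and the input memory itself plays the part of \<open>tgt\<close>.
  \<open>space\<close> covers the input, all arrays and a stack as high as the initial
  potential.\<close>

locale ram_input = token_graph nA n q wB wt start fin inp
  for nA n q wB :: nat and wt start fin inp :: "nat \<Rightarrow> nat" +
  fixes m W :: nat
  assumes inp_header: "inp 0 = nA" "inp (Suc 0) = n - nA" "inp 2 = q"
    and inp_weight: "\<And>v. v < n \<Longrightarrow> inp (3 + v) = wt v"
    and inp_start: "\<And>v. v < n \<Longrightarrow> 2 * n + 4 + inp (3 + n + v) = start v"
    and inp_fin: "\<And>v. v < n \<Longrightarrow> 2 * n + 4 + inp (3 + n + Suc v) = fin v"
    and inp_total: "inp (3 + n + n) = m"
    and inp_zero: "\<And>x. 2 * n + 4 + m \<le> x \<Longrightarrow> inp x = 0"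
    and fin_le: "\<And>v. v < n \<Longrightarrow> fin v \<le> 2 * n + 4 + m"
    and q_word: "q < 2 ^ W"
    and weights_word: "(\<Sum>v<n. wt v) + wB < 2 ^ W"
    and space: "6 * n + m + 5 + (top_label * (2 * m + n) + 2 * m + nA) < 2 ^ W"
    and total_degree: "(\<Sum>v<n. fin v - start v) = m"
    and wB_attained: "wB \<in> wt ` {nA..<n}"
begin

section \<open>Memory layout and word bounds\<close>

definition off0 :: nat where "off0 = 3 + n"
definition adj0 :: nat where "adj0 = 2 * n + 4"
definition d0 :: nat where "d0 = 2 * n + 4 + m"
definition p0 :: nat where "p0 = d0 + n"
definition z0 :: nat where "z0 = p0 + n"
definition k0 :: nat where "k0 = z0 + n"
definition s0 :: nat where "s0 = k0 + n + 1"

text \<open>The initial potential: it bounds the rounds of the main loop and also the height of the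
  stack, which may exceed the number of vertices because entries repeat.\<close>

definition stack_bound :: nat where
  "stack_bound = top_label * (2 * m + n) + 2 * m + nA"

lemmas base_defs = off0_def adj0_def d0_def p0_def z0_def k0_def s0_def

text \<open>The stack comes last, where it can grow. \<open>K\<close> has \<open>n + 1\<close>
  cells, since it is indexed by labels from 0 to \<open>top_label\<close>, which is at most
  \<open>n\<close>. With the read and write rules below, the simplifier executes blocks
  symbolically.\<close>

definition enc ::
  "(nat \<Rightarrow> nat) \<Rightarrow> (nat \<Rightarrow> nat) \<Rightarrow> (nat \<Rightarrow> nat) \<Rightarrow> (nat \<Rightarrow> nat) \<Rightarrow> (nat \<Rightarrow> nat) \<Rightarrow> (nat \<Rightarrow> nat) \<Rightarrow> nat \<Rightarrow> nat"
  where
  "enc I D P Z K S x =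
     (if x < d0 then I x else if x < p0 then D (x - d0) else if x < z0 then P (x - p0)
      else if x < k0 then Z (x - z0) else if x < s0 then K (x - k0) else S (x - s0))"

lemma enc_read [simp]:
  "x < d0 \<Longrightarrow> enc I D P Z K S x = I x"
  "v < n \<Longrightarrow> enc I D P Z K S (d0 + v) = D v"
  "v < n \<Longrightarrow> enc I D P Z K S (p0 + v) = P v"
  "v < n \<Longrightarrow> enc I D P Z K S (z0 + v) = Z v"
  "v \<le> n \<Longrightarrow> enc I D P Z K S (k0 + v) = K v"
  "enc I D P Z K S k0 = K 0"
  "enc I D P Z K S (s0 + v) = S v"
  by (auto simp: enc_def base_defs)

lemma enc_write [simp]:
  "x < d0 \<Longrightarrow> (enc I D P Z K S)(x := y) = enc (I(x := y)) D P Z K S"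
  "v < n \<Longrightarrow> (enc I D P Z K S)(d0 + v := y) = enc I (D(v := y)) P Z K S"
  "v < n \<Longrightarrow> (enc I D P Z K S)(p0 + v := y) = enc I D (P(v := y)) Z K S"
  "v < n \<Longrightarrow> (enc I D P Z K S)(z0 + v := y) = enc I D P (Z(v := y)) K S"
  "v \<le> n \<Longrightarrow> (enc I D P Z K S)(k0 + v := y) = enc I D P Z (K(v := y)) S"
  "(enc I D P Z K S)(s0 + v := y) = enc I D P Z K (S(v := y))"
proof -
  note order = p0_def z0_def k0_def s0_def
  show "x < d0 \<Longrightarrow> (enc I D P Z K S)(x := y) = enc (I(x := y)) D P Z K S"
    by (rule ext, unfold enc_def fun_upd_apply) simp
  have *: "(\<And>x. f x = g x) \<Longrightarrow> f = g" for f g :: "nat \<Rightarrow> nat" by auto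
  show "(enc I D P Z K S)(d0 + v := y) = enc I (D(v := y)) P Z K S" if "v < n"
  proof (rule *)
    fix x
    consider "x < d0" | u where "x = d0 + u" by (metis le_Suc_ex not_less)
    then show "((enc I D P Z K S)(d0 + v := y)) x = enc I (D(v := y)) P Z K S x"
      using that order by cases (auto simp: enc_def)
  qed
  show "(enc I D P Z K S)(p0 + v := y) = enc I D (P(v := y)) Z K S" if "v < n"
  proof (rule *)
    fix x
    consider "x < p0" | u where "x = p0 + u" by (metis le_Suc_ex not_less)
    then show "((enc I D P Z K S)(p0 + v := y)) x = enc I D (P(v := y)) Z K S x"
      using that order by cases (auto simp: enc_def)
  qed
  show "(enc I D P Z K S)(z0 + v := y) = enc I D P (Z(v := y)) K S" if "v < n"
  proof (rule *)
    fix x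
    consider "x < z0" | u where "x = z0 + u" by (metis le_Suc_ex not_less)
    then show "((enc I D P Z K S)(z0 + v := y)) x = enc I D P (Z(v := y)) K S x"
      using that order by cases (auto simp: enc_def)
  qed
  show "(enc I D P Z K S)(k0 + v := y) = enc I D P Z (K(v := y)) S" if "v \<le> n"
  proof (rule *)
    fix x
    consider "x < k0" | u where "x = k0 + u" by (metis le_Suc_ex not_less)
    then show "((enc I D P Z K S)(k0 + v := y)) x = enc I D P Z (K(v := y)) S x"
      using that order by cases (auto simp: enc_def)
  qed
  show "(enc I D P Z K S)(s0 + v := y) = enc I D P Z K (S(v := y))"
  proof (rule *)
    fix x
    consider "x < s0" | u where "x = s0 + u" by (metis le_Suc_ex not_less)
    then show "((enc I D P Z K S)(s0 + v := y)) x = enc I D P Z K (S(v := y)) x"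
      using order by cases (auto simp: enc_def)
  qed
qed

text \<open>The forms into which the simplifier brings addresses with index 0 or a
  successor.\<close>

lemma enc_write' [simp]:
  "(enc I D P Z K S)(k0 := y) = enc I D P Z (K(0 := y)) S"
  "(enc I D P Z K S)(Suc (s0 + v) := y) = enc I D P Z K (S(Suc v := y))"
  using enc_write(5)[of 0] enc_write(6)[of _ _ _ _ _ _ "Suc v"] by simp_all

text \<open>Opaque on purpose: the simplifier is slow on arithmetic with the modulus.\<close>

definition fits :: "nat \<Rightarrow> bool" where "fits x \<longleftrightarrow> x < 2 ^ W"

lemma word_op_fits [simp]:
  "fits (x + y) \<Longrightarrow> word_op W Add x y = x + y"
  "fits x \<Longrightarrow> y \<le> x \<Longrightarrow> word_op W Sub x y = x - y"
  "fits k \<Longrightarrow> k mod 2 ^ W = k"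
proof -
  assume "fits x" "y \<le> x"
  then have "x + 2 ^ W - y = (x - y) + 2 ^ W" "x - y < 2 ^ W" by (auto simp: fits_def)
  then show "word_op W Sub x y = x - y"
    unfolding word_op.simps by (metis mod_add_self2 mod_less)
qed (auto simp: fits_def)

declare word_op.simps [simp del]

lemma s0_stack_word: "s0 + stack_bound < 2 ^ W"
  using space by (simp add: base_defs stack_bound_def)

lemma fits_address [simp]:
  "v \<le> n \<Longrightarrow> fits (off0 + v)" "v < n \<Longrightarrow> fits (off0 + v)" "v < n \<Longrightarrow> fits (Suc (off0 + v))"
  "v < n \<Longrightarrow> fits (d0 + v)" "v < n \<Longrightarrow> fits (p0 + v)" "v < n \<Longrightarrow> fits (z0 + v)"
  "v \<le> n \<Longrightarrow> fits (k0 + v)" "v \<le> stack_bound \<Longrightarrow> fits (s0 + v)"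
  "Suc v \<le> stack_bound \<Longrightarrow> fits (Suc (s0 + v))"
  "v \<le> n \<Longrightarrow> fits (Suc v)" "v < n \<Longrightarrow> fits (3 + v)" "x \<le> d0 \<Longrightarrow> fits (Suc x)"
  "v \<le> stack_bound \<Longrightarrow> fits v" "v < n \<Longrightarrow> fits v"
  using s0_stack_word by (auto simp: base_defs fits_def)

lemma inp_read [simp]:
  "v < n \<Longrightarrow> adj0 + inp (off0 + v) = start v"
  "v < n \<Longrightarrow> adj0 + inp (Suc (off0 + v)) = fin v"
  "v < n \<Longrightarrow> inp (3 + v) = wt v"
  using inp_start[of v] inp_fin[of v] inp_weight[of v] by (simp_all add: base_defs algebra_simps)

lemma input_address [simp]:
  "v \<le> n \<Longrightarrow> off0 + v < d0" "v < n \<Longrightarrow> off0 + v < d0" "v < n \<Longrightarrow> Suc (off0 + v) < d0" "v < n \<Longrightarrow> 3 + v < d0"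
  by (simp_all add: base_defs)

lemma start_fin_fits [simp]:
  "v < n \<Longrightarrow> fits (fin v)" "v < n \<Longrightarrow> fits (start v)"
  using fin_le[of v] start_le_fin[of v] s0_stack_word by (simp_all add: fits_def base_defs)

lemma n_bounds: "nA \<le> n" "top_label \<le> n" "0 < n"
  using nA_pos nA_less by (auto simp: top_label_def)

text \<open>These registers are never written after the header; registers 3, 11 and 14 still change
  and are tracked separately.\<close>

definition fixed :: "(nat \<Rightarrow> nat) \<Rightarrow> bool" where
  "fixed r \<longleftrightarrow> r 0 = nA \<and> r (Suc 0) = n \<and> r 2 = q \<and> r 4 = off0 \<and> r 5 = adj0 \<and> r 6 = d0 \<and> r 7 = p0 \<and>
     r 8 = z0 \<and> r 9 = k0 \<and> r 10 = s0 \<and> r 12 = top_label \<and> r 13 = 1 \<and> r 15 = 3 \<and> r 16 = 0"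

lemma load_le_total:
  assumes "a < nA"
  shows "load Z a \<le> (\<Sum>v<n. wt v)"
proof -
  have "load Z a = (\<Sum>v\<in>insert a {b. nA \<le> b \<and> b < n \<and> Z b = a}. wt v)"
    unfolding load_def using assms by (subst sum.insert) auto
  also have "\<dots> \<le> (\<Sum>v<n. wt v)" using assms nA_less by (intro sum_mono2) auto
  finally show ?thesis .
qed

lemma advance_block_correct:
  assumes "valid (D, P, Z, S, Suc t)" "Suc t \<le> stack_bound"
    and "fixed r" "r 11 = Suc t"
  shows "case advance (D, P, Z, S, Suc t) of (D', P', Z', S', sp') \<Rightarrow>
    \<exists>r'. sem W advance_block (r, enc inp D P Z K S) = (r', enc inp D' P' Z' K S') \<and>
      fixed r' \<and> r' 3 = r 3 \<and> r' 11 = sp'"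
proof -
  define a where "a = S t"
  define b where "b = inp (P a)"
  define c where "c = inp (P b)"
  have v1: "\<And>i. i < Suc t \<Longrightarrow> S i < nA"
    and v2: "\<And>v. v < n \<Longrightarrow> D v \<le> top_label" "\<And>v. v < n \<Longrightarrow> start v \<le> P v" "\<And>v. v < n \<Longrightarrow> P v \<le> fin v"
    and v3: "\<And>b. nA \<le> b \<Longrightarrow> b < n \<Longrightarrow> \<exists>p. start b \<le> p \<and> p < fin b \<and> Z b = inp p"
    and v4: "\<And>a. a < nA \<Longrightarrow> Z a = load Z a"
    using assms(1) unfolding valid_def by auto
  have a: "a < nA" using v1 by (auto simp: a_def)
  then have an: "a < n" using nA_less by simp
  have Sa: "S t = a" by (simp add: a_def)
  have t: "fits (Suc t)" "t \<le> stack_bound" using assms(2) by auto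
  have r: "r 0 = nA" "r (Suc 0) = n" "r 2 = q" "r 4 = off0" "r 5 = adj0" "r 6 = d0" "r 7 = p0"
     "r 8 = z0" "r 9 = k0" "r 10 = s0" "r 12 = top_label" "r 13 = 1" "r 15 = 3" "r 16 = 0" "r 11 = Suc t"
    using assms by (auto simp: fixed_def)
  have Pd: "P v \<le> d0" if "v < n" for v using v2(3)[OF that] fin_le[OF that] by (simp add: d0_def)
  have Pd': "P v < d0" if "v < n" "P v < fin v" for v using that fin_le[OF that(1)] by (simp add: d0_def)
  have Dn: "D v \<le> n" if "v < n" for v using v2(1)[OF that] n_bounds by simp
  consider (pop) "\<not> q < Z a" | (pop2) "q < Z a" "\<not> D a < top_label"
    | (relabel) "q < Z a" "D a < top_label" "\<not> P a < fin a"
    | (proper) "q < Z a" "D a < top_label" "P a < fin a"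
    by blast
  then show ?thesis
  proof cases
    case pop
    then have "advance (D, P, Z, S, Suc t) = (D, P, Z, S, t)"
      by (auto simp: advance_def a_def Let_def)
    then show ?thesis using pop
      by (simp add: advance_block_def fixed_def r t a an Sa)
  next
    case pop2
    then have "advance (D, P, Z, S, Suc t) = (D, P, Z, S, t)"
      by (auto simp: advance_def a_def Let_def)
    then show ?thesis using pop2
      by (simp add: advance_block_def fixed_def r t a an Sa)
  next
    case relabel
    then have "advance (D, P, Z, S, Suc t) = (D(a := D a + 1), P(a := start a), Z, S, Suc t)"
      by (auto simp: advance_def a_def Let_def)
    then show ?thesis using relabel
      by (simp add: advance_block_def fixed_def r t a an Sa Dn)
  next
    case proper
    have b: "nA \<le> b" "b < n" "b \<noteq> a"
      using tgt_A[of a "P a"] a an v2 proper by (auto simp: b_def)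
    note Pa = Pd'[OF an proper(3)]
    show ?thesis
    proof (cases "Z b = a \<and> D b < D a")
      case False
      then have "advance (D, P, Z, S, Suc t) = (D, P(a := P a + 1), Z, S, Suc t)"
        using proper by (auto simp: advance_def a_def b_def Let_def)
      then show ?thesis using proper False
        by (simp add: advance_block_def skip_block_def fixed_def r t a an Sa Dn Pd Pa b b_def[symmetric] less_not_sym)
    next
      case tok: True
      show ?thesis
      proof (cases "P b < fin b")
        case False
        then have "advance (D, P, Z, S, Suc t) = (D(b := D b + 1), P(b := start b), Z, S, Suc t)"
          using proper tok by (auto simp: advance_def a_def b_def Let_def)
        then show ?thesis using proper tok False
          by (simp add: advance_block_def token_block_def fixed_def r t a an Sa Dn Pd Pa b b_def[symmetric])
      next
        case Pb: True
        have c: "c < nA" using tgt_B[of b "P b"] b v2 Pb by (auto simp: c_def)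
        then have cn: "c < n" using nA_less by simp
        note Pb' = Pd'[OF b(2) Pb]
        show ?thesis
        proof (cases "D b < D c")
          case True
          then have "advance (D, P, Z, S, Suc t) = (D, P(b := P b + 1), Z, S, Suc t)"
            using proper tok Pb by (auto simp: advance_def a_def b_def c_def Let_def)
          then show ?thesis using proper tok True Pb
            by (simp add: advance_block_def token_block_def fixed_def r t a an Sa Dn Pd Pa Pb' b c cn
                b_def[symmetric] c_def[symmetric])
        next
          case False
          then have adv: "advance (D, P, Z, S, Suc t) =
              (D, P(a := P a + 1), Z(b := c, a := Z a - wt b, c := Z c + wt b), S(Suc t := c), Suc (Suc t))"
            using proper tok Pb by (auto simp: advance_def a_def b_def c_def Let_def)
          have "c \<noteq> a" using tok False by auto
          note mv = load_move[where Z = Z and a = a and c = c, OF b(1,2) _ \<open>c \<noteq> a\<close>]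
          \<comment> \<open>Subtraction does not wrap around, as the token is part of the load of
            \<open>a\<close>.\<close>
          have Za: "wt b \<le> Z a" "Z a < 2 ^ W"
            using mv tok v4 a load_le_total[OF a, of Z] weights_word by auto
          then have wa: "fits (Z a)" by (simp add: fits_def)
          \<comment> \<open>This sum is the load of \<open>c\<close> after the move, hence at most
            the total weight.\<close>
          have wc: "fits (Z c + wt b)"
            using mv tok v4 c load_le_total[OF c, of "Z(b := c)"] weights_word by (auto simp: fits_def)
          have bc: "b \<noteq> c" using b c by auto
          have sps: "fits (Suc (Suc t))"
            using assms(2) space by (auto simp: stack_bound_def fits_def)
          show ?thesis using adv proper tok False Pb
            by (simp add: advance_block_def token_block_def move_block_def skip_block_def fixed_def
                r t a an Sa Dn Pd Pa Pb' b c cn Za wa wc bc bc[symmetric] sps assms(2) \<open>c \<noteq> a\<close>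
                b_def[symmetric] c_def[symmetric])
        qed
      qed
    qed
  qed
qed

section \<open>The phases, verified from the last to the first\<close>

lemma fixed_reads:
  "fixed r \<Longrightarrow> r 0 = nA" "fixed r \<Longrightarrow> r (Suc 0) = n" "fixed r \<Longrightarrow> r 16 = 0"
  by (simp_all add: fixed_def)

text \<open>The loop destroys input cells, so \<open>Q\<close> has to hold for every
  \<open>I\<close> with the right first \<open>n\<close> cells and for arbitrary registers.\<close>

lemma output_phase:
  assumes "fixed r" "r 14 = 0" "r 18 = k" "\<And>b. nA \<le> b \<Longrightarrow> b < n \<Longrightarrow> Z b < nA"
    and "30 * n + 10 \<le> U"
    and Q: "\<And>r I. (\<And>v. v < n \<Longrightarrow> I v = (if v < nA then if k \<le> D v then 1 else 0 else Z v)) \<Longrightarrow>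
       Q (r, enc I D P Z K S)"
  shows "achieves W [While 14 1 output_block] (r, enc inp D P Z K S) U Q"
proof -
  define out where "out v = (if v < nA then if k \<le> D v then 1 else 0 else Z v)" for v
  define Inv where "Inv j s \<longleftrightarrow> (\<exists>r I. s = (r, enc I D P Z K S) \<and> fixed r \<and> r 18 = k \<and>
      r 14 + j = n \<and> (\<forall>v<r 14. I v = out v))" for j s
  show ?thesis
  proof (rule achieves_While[where I = Inv and k = n and T = 0])
    show "Inv n (r, enc inp D P Z K S)" using assms by (auto simp: Inv_def)
    show "n * (len output_block + 2) + 2 + 0 \<le> U"
      using assms by (simp add: output_block_def)
  next
    fix j s assume inv: "Inv j s" and test: "less_test 14 1 s"
    from inv obtain r I where s: "s = (r, enc I D P Z K S)" and r: "fixed r" "r 18 = k" "r 14 + j = n"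
      and I: "\<forall>v<r 14. I v = out v"
      unfolding Inv_def by blast
    have i: "r 14 < n" using test r by (simp add: s fixed_reads)
    define i where "i = r 14"
    have "i < n" "i < d0" "r 14 = i" using i by (auto simp: i_def base_defs)
    then have "\<exists>r'. sem W output_block s = (r', enc (I(i := out i)) D P Z K S) \<and> fixed r' \<and>
        r' 18 = k \<and> r' 14 = Suc i"
      using r unfolding s by (auto simp: output_block_def fixed_def out_def)
    then obtain r' where "sem W output_block s = (r', enc (I(i := out i)) D P Z K S)" "fixed r'"
        "r' 18 = k" "r' 14 = Suc i" by blast
    then show "\<exists>j'<j. Inv j' (sem W output_block s)"
      using I r i \<open>r 14 = i\<close> unfolding Inv_def
      by - (rule exI[of _ "j - 1"], intro conjI, simp,
          rule exI[of _ r'], rule exI[of _ "I(i := out i)"], auto simp: less_Suc_eq)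
  next
    fix j s assume inv: "Inv j s" and test: "\<not> less_test 14 1 s"
    from inv obtain r I where s: "s = (r, enc I D P Z K S)" and r: "fixed r" "r 14 + j = n"
      and I: "\<forall>v<r 14. I v = out v"
      unfolding Inv_def by blast
    have "n \<le> r 14" using test r by (simp add: s fixed_reads)
    then have "\<forall>v<n. I v = out v" using I by auto
    then show "achieves W [] s 0 Q" unfolding s achieves.simps by (intro Q) (simp add: out_def)
  qed
qed

text \<open>The free positive level \<open>k1\<close> guarantees termination and serves as variant;
  the loop may stop earlier, at 0 or at a smaller free level, which is a threshold just as
  well.\<close>

lemma search_phase:
  assumes "fixed r" "\<And>b. nA \<le> b \<Longrightarrow> b < n \<Longrightarrow> Z b < nA"
    and K: "K 0 = 0 \<longleftrightarrow> (\<forall>a<nA. q < Z a + wB)"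
      "\<And>k. 0 < k \<Longrightarrow> K k = 0 \<longleftrightarrow> (\<forall>b. nA \<le> b \<longrightarrow> b < n \<longrightarrow> D (Z b) \<noteq> k)"
    and "50 * n + 20 \<le> U"
    and Q: "\<And>r I k. is_threshold D Z k \<Longrightarrow>
       (\<And>v. v < n \<Longrightarrow> I v = (if v < nA then if k \<le> D v then 1 else 0 else Z v)) \<Longrightarrow>
       Q (r, enc I D P Z K S)"
  shows "achieves W [Straight (SetC 18 0 ;; Get 17 9), While 16 17 search_block,
    Straight (SetC 14 0), While 14 1 output_block] (r, enc inp D P Z K S) U Q"
proof -
  obtain k1 where k1: "0 < k1" "k1 \<le> top_label" "K k1 = 0"
    using free_level_exists[of "\<lambda>b. D (Z b)"] K(2) by metis
  define Inv where "Inv j s \<longleftrightarrow> (\<exists>r. s = (r, enc inp D P Z K S) \<and> fixed r \<and> r 18 + j = k1 \<and>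
      r 17 = K (r 18) \<and> (\<forall>k<r 18. K k \<noteq> 0))" for j s
  have k1n: "k1 \<le> n" using k1 n_bounds by simp
  have 0: "\<exists>r'. sem W (SetC 18 0 ;; Get 17 9) (r, enc inp D P Z K S) = (r', enc inp D P Z K S) \<and>
      fixed r' \<and> r' 18 = 0 \<and> r' 17 = K 0"
    using assms(1) n_bounds by (simp add: fixed_def)
  show ?thesis
  proof (rule achieves_Straight, rule achieves_While[where I = Inv and k = k1 and T = "30 * n + 11"])
    show "Inv k1 (sem W (SetC 18 0 ;; Get 17 9) (r, enc inp D P Z K S))"
      using 0 by (auto simp: Inv_def simp del: sem.simps)
    show "k1 * (len search_block + 2) + 2 + (30 * n + 11) \<le> 40 * n + 18"
      using k1n by (simp add: search_block_def)
    show "40 * n + 18 + len (SetC 18 0 ;; Get 17 9) \<le> U" using assms by simp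
  next
    fix j s assume inv: "Inv j s" and test: "less_test 16 17 s"
    from inv obtain r where s: "s = (r, enc inp D P Z K S)" and r: "fixed r" "r 18 + j = k1"
      and k: "r 17 = K (r 18)" "\<forall>k<r 18. K k \<noteq> 0"
      unfolding Inv_def by blast
    have k3: "K (r 18) \<noteq> 0" using test r k by (simp add: s fixed_reads)
    define i where "i = r 18"
    \<comment> \<open>At \<open>k1\<close> itself the mark is 0 and the test would have
      failed.\<close>
    have "j \<noteq> 0" using r k3 k1 by (intro notI) simp
    then have "Suc i \<le> n" "i \<le> n" "r 18 = i" using r k1n by (auto simp: i_def)
    then have "\<exists>r'. sem W search_block s = (r', enc inp D P Z K S) \<and> fixed r' \<and>
        r' 18 = Suc i \<and> r' 17 = K (Suc i)"
      using r unfolding s by (simp add: search_block_def fixed_def enc_read(5)[of "Suc i", simplified] fits_address(7)[of "Suc i", simplified])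
    then obtain r' where "sem W search_block s = (r', enc inp D P Z K S)" "fixed r'"
        "r' 18 = Suc i" "r' 17 = K (Suc i)" by blast
    then show "\<exists>j'<j. Inv j' (sem W search_block s)"
      using r k k3 \<open>j \<noteq> 0\<close> \<open>r 18 = i\<close> unfolding Inv_def
      by - (rule exI[of _ "j - 1"], intro conjI, simp,
          rule exI[of _ r'], auto simp: less_Suc_eq)
  next
    fix j s assume inv: "Inv j s" and test: "\<not> less_test 16 17 s"
    from inv obtain r where s: "s = (r, enc inp D P Z K S)" and r: "fixed r" "r 18 + j = k1"
      and k: "r 17 = K (r 18)" "\<forall>k<r 18. K k \<noteq> 0"
      unfolding Inv_def by blast
    have k2: "K (r 18) = 0" using test r k by (simp add: s fixed_reads)
    define k' where "k' = r 18"
    have th: "is_threshold D Z k'"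
      unfolding is_threshold_def
    proof (intro conjI impI)
      show "(k' = 0) = (\<forall>a<nA. q < Z a + wB)"
        using K(1) k k2 unfolding k'_def by (metis gr0I)
      show "\<forall>b. nA \<le> b \<longrightarrow> b < n \<longrightarrow> D (Z b) \<noteq> k'" if "0 < k'" using K(2)[OF that] k2 k'_def by simp
      show "k' \<le> top_label" using r k1 k'_def by simp
    qed
    obtain r' where r': "sem W (SetC 14 0) s = (r', enc inp D P Z K S)" "fixed r'" "r' 14 = 0" "r' 18 = k'"
      using r s by (simp add: fixed_def k'_def)
    show "achieves W [Straight (SetC 14 0), While 14 1 output_block] s (30 * n + 11) Q"
      by (rule achieves_Straight[where T = "30 * n + 10"], unfold r'(1),
          rule output_phase[where k = k', OF r'(2,3,4) assms(2)])
        (use Q[OF th] in auto)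
  qed
qed

lemma sink_phase:
  assumes "fixed r" "r 3 = wB" "\<And>b. nA \<le> b \<Longrightarrow> b < n \<Longrightarrow> Z b < nA" "\<And>a. a < nA \<Longrightarrow> Z a = load Z a"
    and K: "\<And>k. 0 < k \<Longrightarrow> K k = 0 \<longleftrightarrow> (\<forall>b. nA \<le> b \<longrightarrow> b < n \<longrightarrow> D (Z b) \<noteq> k)"
    and "70 * n + 30 \<le> U"
    and Q: "\<And>r I K k. is_threshold D Z k \<Longrightarrow>
       (\<And>v. v < n \<Longrightarrow> I v = (if v < nA then if k \<le> D v then 1 else 0 else Z v)) \<Longrightarrow>
       Q (r, enc I D P Z K S)"
  shows "achieves W [Straight (Put 9 16 ;; SetC 14 0), While 14 0 sink_block,
    Straight (SetC 18 0 ;; Get 17 9), While 16 17 search_block,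
    Straight (SetC 14 0), While 14 1 output_block] (r, enc inp D P Z K S) U Q"
proof -
  define K' where "K' x = K(0 := x)" for x
  define Inv where "Inv j s \<longleftrightarrow> (\<exists>r x. s = (r, enc inp D P Z (K' x) S) \<and> fixed r \<and> r 3 = wB \<and>
      r 14 + j = nA \<and> (x = 0 \<longleftrightarrow> (\<forall>a<r 14. q < Z a + wB)))" for j s
  have 0: "\<exists>r'. sem W (Put 9 16 ;; SetC 14 0) (r, enc inp D P Z K S) = (r', enc inp D P Z (K' 0) S) \<and>
      fixed r' \<and> r' 3 = wB \<and> r' 14 = 0"
    using assms(1,2) n_bounds by (simp add: fixed_def K'_def)
  show ?thesis
  proof (rule achieves_Straight, rule achieves_While[where I = Inv and k = nA and T = "50 * n + 20"])
    show "Inv nA (sem W (Put 9 16 ;; SetC 14 0) (r, enc inp D P Z K S))"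
      using 0 by (auto simp: Inv_def simp del: sem.simps)
    show "nA * (len sink_block + 2) + 2 + (50 * n + 20) \<le> 70 * n + 28"
      using n_bounds by (simp add: sink_block_def)
    show "70 * n + 28 + len (Put 9 16 ;; SetC 14 0) \<le> U" using assms by simp
  next
    fix j s assume inv: "Inv j s" and test: "less_test 14 0 s"
    from inv obtain r x where s: "s = (r, enc inp D P Z (K' x) S)" and r: "fixed r" "r 3 = wB" "r 14 + j = nA"
      and x: "x = 0 \<longleftrightarrow> (\<forall>a<r 14. q < Z a + wB)"
      unfolding Inv_def by blast
    have i: "r 14 < nA" using test r by (simp add: s fixed_reads)
    define i where "i = r 14"
    define x' where "x' = (if q < Z i + wB then x else 1)"
    have "i < nA" "i < n" "r 14 = i" using i nA_less by (auto simp: i_def)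
    moreover have "fits (Z i + wB)"
      using load_le_total[OF \<open>i < nA\<close>, of Z] weights_word assms(4)[OF \<open>i < nA\<close>] by (simp add: fits_def)
    ultimately have "\<exists>r'. sem W sink_block s = (r', enc inp D P Z (K' x') S) \<and> fixed r' \<and>
        r' 3 = wB \<and> r' 14 = Suc i"
      using r unfolding s by (simp add: sink_block_def fixed_def x'_def K'_def)
    then obtain r' where "sem W sink_block s = (r', enc inp D P Z (K' x') S)" "fixed r'"
        "r' 3 = wB" "r' 14 = Suc i" by blast
    then show "\<exists>j'<j. Inv j' (sem W sink_block s)"
      using x r i \<open>r 14 = i\<close> unfolding Inv_def
      by - (rule exI[of _ "j - 1"], intro conjI, simp,
          rule exI[of _ r'], rule exI[of _ x'], auto simp: less_Suc_eq x'_def)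
  next
    fix j s assume inv: "Inv j s" and test: "\<not> less_test 14 0 s"
    from inv obtain r x where s: "s = (r, enc inp D P Z (K' x) S)" and r: "fixed r" "r 3 = wB"
      and r14: "r 14 + j = nA" and x: "x = 0 \<longleftrightarrow> (\<forall>a<r 14. q < Z a + wB)"
      unfolding Inv_def by blast
    have "r 14 = nA" using test r r14 by (simp add: s fixed_reads)
    note x = x[unfolded this]
    show "achieves W [Straight (SetC 18 0 ;; Get 17 9), While 16 17 search_block,
        Straight (SetC 14 0), While 14 1 output_block] s (50 * n + 20) Q"
      unfolding s using x K by (intro search_phase[OF r(1) assms(3)] Q) (auto simp: K'_def)
  qed
qed

lemma mark_phase:
  assumes "fixed r" "r 3 = wB" "\<And>b. nA \<le> b \<Longrightarrow> b < n \<Longrightarrow> Z b < nA" "\<And>a. a < nA \<Longrightarrow> Z a = load Z a"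
    and "\<And>a. a < nA \<Longrightarrow> D a \<le> top_label"
    and "90 * n + 40 \<le> U"
    and Q: "\<And>r I K k. is_threshold D Z k \<Longrightarrow>
       (\<And>v. v < n \<Longrightarrow> I v = (if v < nA then if k \<le> D v then 1 else 0 else Z v)) \<Longrightarrow>
       Q (r, enc I D P Z K S)"
  shows "achieves W [Straight (Op Add 14 0 16), While 14 1 mark_block,
    Straight (Put 9 16 ;; SetC 14 0), While 14 0 sink_block,
    Straight (SetC 18 0 ;; Get 17 9), While 16 17 search_block,
    Straight (SetC 14 0), While 14 1 output_block] (r, enc inp D P Z (\<lambda>_. 0) S) U Q"
proof -
  define Inv where "Inv j s \<longleftrightarrow> (\<exists>r K. s = (r, enc inp D P Z K S) \<and> fixed r \<and> r 3 = wB \<and> nA \<le> r 14 \<and>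
      r 14 + j = n \<and> (\<forall>k. K k = 0 \<longleftrightarrow> (\<forall>b. nA \<le> b \<longrightarrow> b < r 14 \<longrightarrow> D (Z b) \<noteq> k)))" for j s
  have 0: "\<exists>r'. sem W (Op Add 14 0 16) (r, enc inp D P Z (\<lambda>_. 0) S) = (r', enc inp D P Z (\<lambda>_. 0) S) \<and>
      fixed r' \<and> r' 3 = wB \<and> r' 14 = nA"
    using assms(1,2) nA_less by (simp add: fixed_def)
  show ?thesis
  proof (rule achieves_Straight, rule achieves_While[where I = Inv and k = "n - nA" and T = "70 * n + 30"])
    show "Inv (n - nA) (sem W (Op Add 14 0 16) (r, enc inp D P Z (\<lambda>_. 0) S))"
      using 0 nA_less by (auto simp: Inv_def simp del: sem.simps)
    have "(n - nA) * (len mark_block + 2) \<le> n * (len mark_block + 2)" by (rule mult_right_mono) auto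
    then show "(n - nA) * (len mark_block + 2) + 2 + (70 * n + 30) \<le> 90 * n + 39"
      by (simp add: mark_block_def)
    show "90 * n + 39 + len (Op Add 14 0 16) \<le> U" using assms by simp
  next
    fix j s assume inv: "Inv j s" and test: "less_test 14 1 s"
    from inv obtain r K where s: "s = (r, enc inp D P Z K S)" and r: "fixed r" "r 3 = wB" "nA \<le> r 14" "r 14 + j = n"
      and K: "\<And>k. K k = 0 \<longleftrightarrow> (\<forall>b. nA \<le> b \<longrightarrow> b < r 14 \<longrightarrow> D (Z b) \<noteq> k)"
      unfolding Inv_def by blast
    have i: "r 14 < n" using test r by (simp add: s fixed_reads)
    define i where "i = r 14"
    define d where "d = D (Z i)"
    have "i < n" "r 14 = i" "nA \<le> i" using i r by (auto simp: i_def)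
    moreover from this have "Z i < nA" using assms(3) by simp
    moreover from this have "Z i < n" "d \<le> n" using assms(5)[of "Z i"] nA_less n_bounds by (auto simp: d_def)
    ultimately have "\<exists>r'. sem W mark_block s = (r', enc inp D P Z (K(d := 1)) S) \<and> fixed r' \<and>
        r' 3 = wB \<and> r' 14 = Suc i"
      using r unfolding s by (simp add: mark_block_def fixed_def d_def)
    then obtain r' where "sem W mark_block s = (r', enc inp D P Z (K(d := 1)) S)" "fixed r'"
        "r' 3 = wB" "r' 14 = Suc i" by blast
    then show "\<exists>j'<j. Inv j' (sem W mark_block s)"
      using K r i \<open>r 14 = i\<close> unfolding Inv_def
      by - (rule exI[of _ "j - 1"], intro conjI, simp,
          rule exI[of _ r'], rule exI[of _ "K(d := 1)"], auto simp: less_Suc_eq d_def)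
  next
    fix j s assume inv: "Inv j s" and test: "\<not> less_test 14 1 s"
    from inv obtain r K where s: "s = (r, enc inp D P Z K S)" and r: "fixed r" "r 3 = wB"
      and r14: "r 14 + j = n" and K: "\<And>k. K k = 0 \<longleftrightarrow> (\<forall>b. nA \<le> b \<longrightarrow> b < r 14 \<longrightarrow> D (Z b) \<noteq> k)"
      unfolding Inv_def by blast
    have "r 14 = n" using test r r14 by (simp add: s fixed_reads)
    note K = K[unfolded this]
    show "achieves W [Straight (Put 9 16 ;; SetC 14 0), While 14 0 sink_block,
        Straight (SetC 18 0 ;; Get 17 9), While 16 17 search_block,
        Straight (SetC 14 0), While 14 1 output_block] s (70 * n + 30) Q"
      unfolding s using K by (intro sink_phase[where Z = Z and D = D and r = r, OF r assms(3,4)] Q) auto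
  qed
qed

definition solved :: "store \<Rightarrow> bool" where
  "solved s \<longleftrightarrow> (\<exists>D P Z S k. valid (D, P, Z, S, 0) \<and> is_threshold D Z k \<and>
     (\<forall>v<n. snd s v = (if v < nA then if k \<le> D v then 1 else 0 else Z v)))"

text \<open>The potential is the variant. As the stack height is one of its summands, keeping it at
  most \<open>stack_bound\<close> also keeps all stack addresses within words.\<close>

lemma advance_phase:
  assumes "fixed r" "r 3 = wB" "r 11 = sp" "valid (D, P, Z, S, sp)"
    and "potential (D, P, Z, S, sp) \<le> stack_bound"
    and "100 * stack_bound + 90 * n + 42 \<le> U"
  shows "achieves W [While 16 11 advance_block, Straight (Op Add 14 0 16), While 14 1 mark_block,
    Straight (Put 9 16 ;; SetC 14 0), While 14 0 sink_block,
    Straight (SetC 18 0 ;; Get 17 9), While 16 17 search_block,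
    Straight (SetC 14 0), While 14 1 output_block] (r, enc inp D P Z (\<lambda>_. 0) S) U solved"
proof -
  define Inv where "Inv j s \<longleftrightarrow> (\<exists>r D P Z S sp. s = (r, enc inp D P Z (\<lambda>_. 0) S) \<and> fixed r \<and> r 3 = wB \<and>
      r 11 = sp \<and> valid (D, P, Z, S, sp) \<and> potential (D, P, Z, S, sp) = j \<and> j \<le> stack_bound)" for j s
  have pot: "sp \<le> potential (D, P, Z, S, sp)" for D P Z S sp
    by (simp add: potential_def)
  show ?thesis
  proof (rule achieves_While[where I = Inv and k = "potential (D, P, Z, S, sp)" and T = "90 * n + 40"])
    show "Inv (potential (D, P, Z, S, sp)) (r, enc inp D P Z (\<lambda>_. 0) S)"
      using assms unfolding Inv_def by blast
    have "len advance_block + 2 \<le> 100"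
      by (simp add: advance_block_def token_block_def move_block_def skip_block_def)
    then have "potential (D, P, Z, S, sp) * (len advance_block + 2) \<le> stack_bound * 100"
      using assms(5) by (intro mult_mono) auto
    then show "potential (D, P, Z, S, sp) * (len advance_block + 2) + 2 + (90 * n + 40) \<le> U"
      using assms(6) by simp
  next
    fix j s assume inv: "Inv j s" and test: "less_test 16 11 s"
    from inv obtain r D P Z S sp where s: "s = (r, enc inp D P Z (\<lambda>_. 0) S)" and r: "fixed r" "r 3 = wB"
      "r 11 = sp" and v: "valid (D, P, Z, S, sp)" "potential (D, P, Z, S, sp) = j" "j \<le> stack_bound"
      unfolding Inv_def by blast
    have "0 < sp" using test r by (simp add: s fixed_reads)
    obtain t where t: "sp = Suc t" using \<open>0 < sp\<close> gr0_implies_Suc by blast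
    obtain D' P' Z' S' sp' where adv: "advance (D, P, Z, S, Suc t) = (D', P', Z', S', sp')"
      by (metis prod_cases5)
    have "Suc t \<le> stack_bound" using pot[of sp D P Z S] v t by simp
    from advance_block_correct[OF v(1)[unfolded t] this r(1) r(3)[unfolded t], of "\<lambda>_. 0"]
    obtain r' where "sem W advance_block s = (r', enc inp D' P' Z' (\<lambda>_. 0) S')"
      "fixed r'" "r' 3 = wB" "r' 11 = sp'"
      using r by (auto simp: s adv)
    moreover have "valid (D', P', Z', S', sp')" "potential (D', P', Z', S', sp') < j"
      using advance_valid[OF v(1) \<open>0 < sp\<close>] v(2) by (auto simp: t adv)
    ultimately show "\<exists>j'<j. Inv j' (sem W advance_block s)"
      using v(3) unfolding Inv_def
      by - (rule exI[of _ "potential (D', P', Z', S', sp')"], intro conjI, simp,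
          rule exI[of _ r'], rule exI[of _ D'], rule exI[of _ P'], rule exI[of _ Z'], rule exI[of _ S'], rule exI[of _ sp'], auto)
  next
    fix j s assume inv: "Inv j s" and test: "\<not> less_test 16 11 s"
    from inv obtain r D P Z S sp where s: "s = (r, enc inp D P Z (\<lambda>_. 0) S)" and r: "fixed r" "r 3 = wB"
      and r11: "r 11 = sp" and v: "valid (D, P, Z, S, sp)"
      unfolding Inv_def by blast
    have "sp = 0" using test r r11 by (simp add: s fixed_reads)
    note v = v[unfolded this]
    have "Z b < nA" if b: "nA \<le> b" "b < n" for b
    proof -
      from v b obtain p where "start b \<le> p" "p < fin b" "Z b = inp p" unfolding valid_def by auto
      then show ?thesis using tgt_B b by auto
    qed
    moreover have "Z a = load Z a" "D a \<le> top_label" if "a < nA" for a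
      using v that nA_less by (auto simp: valid_def)
    moreover have "solved (r, enc I D P Z K S)" if "is_threshold D Z k"
      "\<And>v. v < n \<Longrightarrow> I v = (if v < nA then if k \<le> D v then 1 else 0 else Z v)" for r I K k
      using v that unfolding solved_def by (auto simp: enc_def base_defs)
    ultimately show "achieves W [Straight (Op Add 14 0 16), While 14 1 mark_block,
        Straight (Put 9 16 ;; SetC 14 0), While 14 0 sink_block,
        Straight (SetC 18 0 ;; Get 17 9), While 16 17 search_block,
        Straight (SetC 14 0), While 14 1 output_block] s (90 * n + 40) solved"
      unfolding s by (intro mark_phase[OF r]) auto
  qed
qed

lemma init_B_phase:
  assumes "fixed r" "r 3 = 0" "r 14 = nA"
    and "\<And>v. v < nA \<Longrightarrow> P v = start v \<and> Z v = wt v \<and> S v = v"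
    and "100 * stack_bound + 120 * n + 50 \<le> U"
  shows "achieves W [Straight (Op Add 11 0 16), While 14 1 init_B_block,
    While 16 11 advance_block, Straight (Op Add 14 0 16), While 14 1 mark_block,
    Straight (Put 9 16 ;; SetC 14 0), While 14 0 sink_block,
    Straight (SetC 18 0 ;; Get 17 9), While 16 17 search_block,
    Straight (SetC 14 0), While 14 1 output_block] (r, enc inp (\<lambda>_. 0) P Z (\<lambda>_. 0) S) U solved"
proof -
  \<comment> \<open>The sums range over the tokens treated so far: the entry of a later token is
    still meaningless, yet it could be read as the number of a host.\<close>
  define Inv where "Inv j s \<longleftrightarrow> (\<exists>r P Z. s = (r, enc inp (\<lambda>_. 0) P Z (\<lambda>_. 0) S) \<and> fixed r \<and>
      nA \<le> r 14 \<and> r 14 + j = n \<and> r 11 = nA \<and>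
      (\<forall>b. nA \<le> b \<longrightarrow> b < r 14 \<longrightarrow> wt b \<le> r 3 \<and> Z b = inp (start b)) \<and> r 3 \<le> wB \<and>
      (\<forall>v<r 14. P v = start v) \<and>
      (\<forall>a<nA. Z a = wt a + (\<Sum>b\<in>{b. nA \<le> b \<and> b < r 14 \<and> Z b = a}. wt b)))" for j s
  have 0: "\<exists>r'. sem W (Op Add 11 0 16) (r, enc inp (\<lambda>_. 0) P Z (\<lambda>_. 0) S) =
      (r', enc inp (\<lambda>_. 0) P Z (\<lambda>_. 0) S) \<and> fixed r' \<and> r' 3 = 0 \<and> r' 11 = nA \<and> r' 14 = nA"
    using assms(1,2,3) nA_less by (simp add: fixed_def)
  show ?thesis
  proof (rule achieves_Straight,
      rule achieves_While[where I = Inv and k = "n - nA" and T = "100 * stack_bound + 90 * n + 42"])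
    have "{b. nA \<le> b \<and> b < nA \<and> Z b = a} = {}" for a by auto
    moreover obtain r' where "sem W (Op Add 11 0 16) (r, enc inp (\<lambda>_. 0) P Z (\<lambda>_. 0) S) =
        (r', enc inp (\<lambda>_. 0) P Z (\<lambda>_. 0) S)" "fixed r'" "r' 3 = 0" "r' 11 = nA" "r' 14 = nA"
      using 0 by blast
    ultimately show "Inv (n - nA) (sem W (Op Add 11 0 16) (r, enc inp (\<lambda>_. 0) P Z (\<lambda>_. 0) S))"
      using nA_less assms(4) unfolding Inv_def
      by - (rule exI[of _ r'], rule exI[of _ P], rule exI[of _ Z], simp del: sem.simps)
    have "(n - nA) * (len init_B_block + 2) \<le> n * (len init_B_block + 2)" by (rule mult_right_mono) auto
    then show "(n - nA) * (len init_B_block + 2) + 2 + (100 * stack_bound + 90 * n + 42)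
        \<le> 100 * stack_bound + 120 * n + 44"
      by (simp add: init_B_block_def)
    show "100 * stack_bound + 120 * n + 44 + len (Op Add 11 0 16) \<le> U" using assms by simp
  next
    fix j s assume inv: "Inv j s" and test: "less_test 14 1 s"
    from inv obtain r P Z where s: "s = (r, enc inp (\<lambda>_. 0) P Z (\<lambda>_. 0) S)"
      and r: "fixed r" "nA \<le> r 14" "r 14 + j = n" "r 11 = nA" "r 3 \<le> wB"
      and wZ: "\<forall>b. nA \<le> b \<longrightarrow> b < r 14 \<longrightarrow> wt b \<le> r 3 \<and> Z b = inp (start b)"
      and P: "\<forall>v<r 14. P v = start v"
      and Z: "\<forall>a<nA. Z a = wt a + (\<Sum>b\<in>{b. nA \<le> b \<and> b < r 14 \<and> Z b = a}. wt b)"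
      unfolding Inv_def by blast
    have "r 14 < n" using test r by (simp add: s fixed_reads)
    note r = r this
    define i where "i = r 14"
    define c where "c = inp (start i)"
    define Z' where "Z' = Z(i := c, c := Z c + wt i)"
    have i: "i < n" "nA \<le> i" "r 14 = i" using r by (auto simp: i_def)
    have c: "c < nA" using tgt_B[of i "start i"] i start_less_fin by (auto simp: c_def)
    then have cn: "c < n" "c \<noteq> i" using i by auto
    have start: "start i < d0" using start_less_fin[OF i(2,1)] fin_le[OF i(1)] by (simp add: d0_def)
    have sets: "{b. nA \<le> b \<and> b < Suc i \<and> Z' b = c} = insert i {b. nA \<le> b \<and> b < i \<and> Z b = c}"
      "a \<noteq> c \<Longrightarrow> a < nA \<Longrightarrow> {b. nA \<le> b \<and> b < Suc i \<and> Z' b = a} = {b. nA \<le> b \<and> b < i \<and> Z b = a}" for a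
      using c i cn by (auto simp: Z'_def less_Suc_eq)
    have Z'_load: "Z' a = wt a + (\<Sum>b | nA \<le> b \<and> b < Suc i \<and> Z' b = a. wt b)" if "a < nA" for a
    proof (cases "a = c")
      case True
      then show ?thesis using Z that i c by (simp add: sets(1)) (simp add: Z'_def)
    next
      case False
      then show ?thesis using Z that i by (simp add: sets(2)) (simp add: Z'_def)
    qed
    have wB: "wt i \<le> wB" using wt_le i by simp
    have "(\<Sum>b | nA \<le> b \<and> b < Suc i \<and> Z' b = c. wt b) + wt c = (\<Sum>v\<in>insert c {b. nA \<le> b \<and> b < Suc i \<and> Z' b = c}. wt v)"
      using c by (subst sum.insert) auto
    also have "\<dots> \<le> (\<Sum>v<n. wt v)" using cn i by (intro sum_mono2) auto
    finally have "Z' c < 2 ^ W" using Z'_load[OF c] weights_word by simp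
    then have zc: "fits (Z c + wt i)" by (simp add: fits_def Z'_def)
    have wi: "fits (wt i)" using wB weights_word by (simp add: fits_def)
    have "\<exists>r'. sem W init_B_block s = (r', enc inp (\<lambda>_. 0) (P(i := start i)) Z' (\<lambda>_. 0) S) \<and> fixed r' \<and>
        r' 14 = Suc i \<and> r' 11 = nA \<and> r' 3 = max (r 3) (wt i)"
      using r(1,4) i c cn start zc wi unfolding s
      by (simp add: init_B_block_def fixed_def Z'_def c_def[symmetric])
    then obtain r' where r': "sem W init_B_block s = (r', enc inp (\<lambda>_. 0) (P(i := start i)) Z' (\<lambda>_. 0) S)"
       "fixed r'" "r' 14 = Suc i" "r' 11 = nA" "r' 3 = max (r 3) (wt i)" by blast
    have "wt b \<le> r' 3 \<and> Z' b = inp (start b)" if "nA \<le> b" "b < Suc i" for b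
      using wZ that r'(5) c i unfolding Z'_def by (cases "b = i") (auto simp: c_def le_max_iff_disj)
    then show "\<exists>j'<j. Inv j' (sem W init_B_block s)"
      unfolding Inv_def using r r' Z'_load wB P i
      by - (rule exI[of _ "j - 1"], intro conjI, simp,
          rule exI[of _ r'], rule exI[of _ "P(i := start i)"], rule exI[of _ Z'], auto simp: less_Suc_eq)
  next
    fix j s assume inv: "Inv j s" and test: "\<not> less_test 14 1 s"
    from inv obtain r P Z where s: "s = (r, enc inp (\<lambda>_. 0) P Z (\<lambda>_. 0) S)"
      and r: "fixed r" "r 11 = nA" "r 3 \<le> wB" and r14: "r 14 + j = n"
      and wZ: "\<forall>b. nA \<le> b \<longrightarrow> b < r 14 \<longrightarrow> wt b \<le> r 3 \<and> Z b = inp (start b)"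
      and P: "\<forall>v<r 14. P v = start v"
      and Z: "\<forall>a<nA. Z a = wt a + (\<Sum>b\<in>{b. nA \<le> b \<and> b < r 14 \<and> Z b = a}. wt b)"
      unfolding Inv_def by blast
    have "r 14 = n" using test r r14 by (simp add: s fixed_reads)
    note wZ = wZ[unfolded this] and P = P[unfolded this] and Z = Z[unfolded this]
    \<comment> \<open>Register 3 dominates all token weights without exceeding \<open>wB\<close>,
      and some token attains \<open>wB\<close>.\<close>
    have "r 3 = wB" using r(3) wZ wB_attained by force
    have "valid (\<lambda>_. 0, P, Z, S, nA)" "potential (\<lambda>_. 0, P, Z, S, nA) = stack_bound"
      using valid_init[of P Z S] P wZ Z assms(4) by (auto simp: load_def stack_bound_def total_degree)
    then show "achieves W [While 16 11 advance_block, Straight (Op Add 14 0 16), While 14 1 mark_block,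
        Straight (Put 9 16 ;; SetC 14 0), While 14 0 sink_block,
        Straight (SetC 18 0 ;; Get 17 9), While 16 17 search_block,
        Straight (SetC 14 0), While 14 1 output_block] s (100 * stack_bound + 90 * n + 42) solved"
      unfolding s by (intro advance_phase[OF r(1) \<open>r 3 = wB\<close> r(2)]) auto
  qed
qed

lemma header_block_correct:
  "\<exists>r. sem W header_block (\<lambda>_. 0, inp) = (r, inp) \<and> fixed r \<and> r 3 = 0 \<and> r 14 = 0"
proof -
  have small: "fits x" if "x \<le> s0" for x
    using that s0_stack_word by (simp add: fits_def)
  have fits: "fits 0" "fits (Suc 0)" "fits 2" "fits 3" "fits n" "fits (Suc (n - nA))" "fits off0"
    "fits (off0 + n)" "fits adj0" "fits d0" "fits p0" "fits z0" "fits k0" "fits (k0 + n)" "fits s0"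
    by (auto intro!: small simp: base_defs)
  have fold: "3 + n = off0" "Suc (off0 + n) = adj0" "adj0 + m = d0" "d0 + n = p0" "p0 + n = z0"
    "z0 + n = k0" "Suc (k0 + n) = s0" "inp (off0 + n) = m"
    using inp_total by (simp_all add: base_defs)
  have SetC: "sem W (SetC i k) s = ((fst s)(i := k), snd s)" if "fits k" for i k s
    using that by simp
  show ?thesis
    using n_bounds(1)
    by (simp add: header_block_def SetC fixed_def fits fold inp_header top_label_def del: sem.simps(1))
qed

lemma expansion_phases_correct:
  "achieves W expansion_phases (\<lambda>_. 0, inp) (100 * stack_bound + 150 * n + 100) solved"
proof -
  obtain r where r: "sem W header_block (\<lambda>_. 0, inp) = (r, inp)" "fixed r" "r 3 = 0" "r 14 = 0"
    using header_block_correct by blast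
  define Inv where "Inv j s \<longleftrightarrow> (\<exists>r P Z S. s = (r, enc inp (\<lambda>_. 0) P Z (\<lambda>_. 0) S) \<and> fixed r \<and>
      r 3 = 0 \<and> r 14 + j = nA \<and> (\<forall>v<r 14. P v = start v \<and> Z v = wt v \<and> S v = v))" for j s
  \<comment> \<open>Memory behind the input is 0, so labels and marks need no
    initialization.\<close>
  have inp_enc: "inp = enc inp (\<lambda>_. 0) (\<lambda>_. 0) (\<lambda>_. 0) (\<lambda>_. 0) (\<lambda>_. 0)"
    using inp_zero by (auto simp: fun_eq_iff enc_def d0_def)
  show ?thesis
    unfolding expansion_phases_def
  proof (rule achieves_Straight, rule achieves_While[where I = Inv and k = nA
        and T = "100 * stack_bound + 120 * n + 50"])
    show "Inv nA (sem W header_block (\<lambda>_. 0, inp))"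
      unfolding Inv_def r(1)
      by (intro exI conjI, subst inp_enc, rule refl) (use r in auto)
    show "nA * (len init_A_block + 2) + 2 + (100 * stack_bound + 120 * n + 50)
        \<le> 100 * stack_bound + 150 * n + 60"
      using n_bounds by (simp add: init_A_block_def)
    show "100 * stack_bound + 150 * n + 60 + len header_block \<le> 100 * stack_bound + 150 * n + 100"
      by (simp add: header_block_def)
  next
    fix j s assume inv: "Inv j s" and test: "less_test 14 0 s"
    from inv obtain r P Z S where s: "s = (r, enc inp (\<lambda>_. 0) P Z (\<lambda>_. 0) S)"
      and r: "fixed r" "r 3 = 0" "r 14 + j = nA"
      and PZS: "\<forall>v<r 14. P v = start v \<and> Z v = wt v \<and> S v = v"
      unfolding Inv_def by blast
    have "r 14 < nA" using test r by (simp add: s fixed_reads)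
    note r = r this
    define i where "i = r 14"
    have i: "i < n" "i \<le> stack_bound" "r 14 = i" using r nA_less by (auto simp: i_def stack_bound_def)
    have "\<exists>r'. sem W init_A_block s =
        (r', enc inp (\<lambda>_. 0) (P(i := start i)) (Z(i := wt i)) (\<lambda>_. 0) (S(i := i))) \<and>
        fixed r' \<and> r' 3 = 0 \<and> r' 14 = Suc i"
      using r(1,2) i unfolding s by (simp add: init_A_block_def fixed_def)
    then obtain r' where "sem W init_A_block s =
        (r', enc inp (\<lambda>_. 0) (P(i := start i)) (Z(i := wt i)) (\<lambda>_. 0) (S(i := i)))"
        "fixed r'" "r' 3 = 0" "r' 14 = Suc i" by blast
    then show "\<exists>j'<j. Inv j' (sem W init_A_block s)"
      unfolding Inv_def using r PZS i
      by - (rule exI[of _ "j - 1"], intro conjI, simp,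
          rule exI[of _ r'], rule exI[of _ "P(i := start i)"], rule exI[of _ "Z(i := wt i)"], rule exI[of _ "S(i := i)"], auto simp: less_Suc_eq)
  next
    fix j s assume inv: "Inv j s" and test: "\<not> less_test 14 0 s"
    from inv obtain r P Z S where s: "s = (r, enc inp (\<lambda>_. 0) P Z (\<lambda>_. 0) S)"
      and r: "fixed r" "r 3 = 0" and r14: "r 14 + j = nA" and PZS: "\<forall>v<r 14. P v = start v \<and> Z v = wt v \<and> S v = v"
      unfolding Inv_def by blast
    have "r 14 = nA" using test r r14 by (simp add: s fixed_reads)
    note PZS = PZS[unfolded this] and r = r this
    show "achieves W [Straight (Op Add 11 0 16), While 14 1 init_B_block,
        While 16 11 advance_block, Straight (Op Add 14 0 16), While 14 1 mark_block,
        Straight (Put 9 16 ;; SetC 14 0), While 14 0 sink_block,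
        Straight (SetC 18 0 ;; Get 17 9), While 16 17 search_block,
        Straight (SetC 14 0), While 14 1 output_block] s (100 * stack_bound + 120 * n + 50) solved"
      unfolding s by (rule init_B_phase[OF r]) (use PZS in auto)
  qed
qed

end

section \<open>Encoded graphs\<close>

lemma nth_concat_offset:
  assumes "v < length xss" "i < length (xss ! v)"
  shows "concat xss ! ((\<Sum>j<v. length (xss ! j)) + i) = xss ! v ! i"
proof -
  have "(\<Sum>j<v. length (xss ! j)) = length (concat (take v xss))"
    using assms(1) by (simp add: length_concat sum_list_sum_nth atLeast0LessThan min_def)
  moreover have "concat xss = concat (take v xss) @ xss ! v @ concat (drop (Suc v) xss)"
    using assms(1) by (metis concat.simps(2) concat_append id_take_nth_drop)
  ultimately show ?thesis using assms(2) by (simp add: nth_append)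
qed

locale encoded_graph =
  fixes A B :: "'v set" and E :: "'v set set" and w :: "'v \<Rightarrow> nat" and q :: nat
    and as bs :: "'v list" and adj :: "nat list list" and W :: nat
  assumes graph: "weighted_bipartite_graph A B E w"
    and B_nonempty: "B \<noteq> {}"
    and no_isolated: "\<And>b. b \<in> B \<Longrightarrow> nbh E b \<noteq> {}"
    and q_ge: "Max (w ` B) \<le> q"
    and as: "enumerates as A" and bs: "enumerates bs B"
    and adj: "adjacency_lists E (as @ bs) adj"
    and W_large: "(card (A \<union> B) + Max (w ` (A \<union> B))) ^ 6 \<le> 2 ^ W"
    and q_word: "q < 2 ^ W"
begin

abbreviation vs :: "'v list" where "vs \<equiv> as @ bs"
definition nA :: nat where "nA = length as"
definition n :: nat where "n = length vs"
definition wt :: "nat \<Rightarrow> nat" where "wt v = w (vs ! v)"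
definition off :: "nat \<Rightarrow> nat" where "off v = (\<Sum>j<v. length (adj ! j))"
definition start :: "nat \<Rightarrow> nat" where "start v = 2 * n + 4 + off v"
definition fin :: "nat \<Rightarrow> nat" where "fin v = 2 * n + 4 + off (Suc v)"
definition inp :: "nat \<Rightarrow> nat" where "inp = mem (init_config (input_words w q as bs adj))"
definition m :: nat where "m = length (concat adj)"
definition wB :: nat where "wB = Max (w ` B)"

section \<open>Vertex numbers and input words\<close>

lemma finite_AB: "finite A" "finite B" and disjoint: "A \<inter> B = {}"
  and edges: "\<And>e. e \<in> E \<Longrightarrow> \<exists>a\<in>A. \<exists>b\<in>B. e = {a, b}"
  and w_pos: "\<And>v. v \<in> A \<union> B \<Longrightarrow> 0 < w v"
  using graph by (auto simp: weighted_bipartite_graph_def)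

lemma finite_E: "finite E"
proof (rule finite_subset)
  show "E \<subseteq> Pow (A \<union> B)" using edges by blast
qed (use finite_AB in simp)

lemma vs: "distinct vs" "set vs = A \<union> B" "set as = A" "set bs = B"
  using as bs disjoint by (auto simp: enumerates_def)

lemma n_card: "n = card (A \<union> B)" "nA = card A" "length bs = card B" "n = nA + length bs"
  using vs distinct_card[of vs] distinct_card[of as] distinct_card[of bs] by (auto simp: n_def nA_def)

lemma vertex_A: "v < nA \<Longrightarrow> vs ! v \<in> A"
  using vs(3) by (auto simp: nA_def nth_append)

lemma vertex_B: "nA \<le> v \<Longrightarrow> v < n \<Longrightarrow> vs ! v \<in> B"
  using vs(4) by (auto simp: nA_def n_def nth_append)

lemma A_image: "A = (!) vs ` {..<nA}"
proof -
  have "A = (!) as ` {..<nA}" using vs(3) by (auto simp: nA_def in_set_conv_nth)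
  then show ?thesis by (auto simp: nA_def nth_append)
qed

lemma B_image: "B = (!) vs ` {nA..<n}"
proof -
  have "b \<in> (!) vs ` {nA..<n}" if b: "b \<in> B" for b
  proof -
    obtain i where i: "i < length vs" "vs ! i = b"
      using b vs(2) by (metis UnI2 in_set_conv_nth)
    then have "\<not> i < nA" using b vertex_A[of i] disjoint by auto
    then show ?thesis using i by (auto simp: n_def intro!: image_eqI[of _ _ i])
  qed
  then show ?thesis using vertex_B by auto
qed

lemma vs_inj: "inj_on ((!) vs) {..<n}"
  using vs(1) by (simp add: n_def inj_on_nth)

lemma vs_eq_iff: "u < n \<Longrightarrow> v < n \<Longrightarrow> vs ! u = vs ! v \<longleftrightarrow> u = v"
  using vs(1) unfolding n_def by (rule nth_eq_iff_index_eq)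

lemma length_adj: "length adj = n"
  using adj by (simp add: adjacency_lists_def n_def)

lemma adj_set: "v < n \<Longrightarrow> set (adj ! v) = {u. u < n \<and> {vs ! v, vs ! u} \<in> E}"
  and adj_distinct: "v < n \<Longrightarrow> distinct (adj ! v)"
  using adj by (auto simp: adjacency_lists_def enumerates_def n_def)

lemma adj_sym: "v < n \<Longrightarrow> u \<in> set (adj ! v) \<Longrightarrow> u < n \<and> v \<in> set (adj ! u)"
  using adj_set by (auto simp: insert_commute)

lemma adj_A: "v < nA \<Longrightarrow> u \<in> set (adj ! v) \<Longrightarrow> nA \<le> u \<and> u < n"
proof -
  assume v: "v < nA" and u: "u \<in> set (adj ! v)"
  have "v < n" using v n_card by simp
  then have "u < n" "{vs ! v, vs ! u} \<in> E" using adj_set u by auto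
  then have "vs ! u \<notin> A" using edges vertex_A[OF v] disjoint by (fastforce simp: doubleton_eq_iff)
  then show "nA \<le> u \<and> u < n" using \<open>u < n\<close> vertex_A by (meson not_le)
qed

lemma adj_B: "nA \<le> v \<Longrightarrow> v < n \<Longrightarrow> u \<in> set (adj ! v) \<Longrightarrow> u < nA"
proof -
  assume v: "nA \<le> v" "v < n" and u: "u \<in> set (adj ! v)"
  then have "u < n" "{vs ! v, vs ! u} \<in> E" using adj_set u by auto
  then have "vs ! u \<notin> B" using edges vertex_B[OF v] disjoint by (fastforce simp: doubleton_eq_iff)
  then show "u < nA" using \<open>u < n\<close> vertex_B by (meson not_le)
qed

lemma off_Suc: "off (Suc v) = off v + length (adj ! v)"
  by (simp add: off_def)

lemma off_n: "off n = m"
  using length_adj by (simp add: off_def m_def length_concat sum_list_sum_nth atLeast0LessThan)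

lemma off_le: "v \<le> n \<Longrightarrow> off v \<le> m"
  unfolding off_n[symmetric] unfolding off_def by (intro sum_mono2) auto

lemma length_input: "length (input_words w q as bs adj) = 2 * n + 4 + m"
  using length_adj by (simp add: input_words_def n_def m_def)

lemma inp_eq: "inp i = (if i < 2 * n + 4 + m then input_words w q as bs adj ! i else 0)"
  using length_input by (simp add: inp_def init_config_def)

lemma inp_words:
  "inp 0 = nA" "inp (Suc 0) = n - nA" "inp 2 = q"
  "v < n \<Longrightarrow> inp (3 + v) = wt v"
  "v \<le> n \<Longrightarrow> inp (3 + n + v) = off v"
  "i < m \<Longrightarrow> inp (2 * n + 4 + i) = concat adj ! i"
  "2 * n + 4 + m \<le> i \<Longrightarrow> inp i = 0"
proof -
  define weights offsets where "weights = map w vs" and "offsets = map off [0..<n + 1]"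
  have len: "length weights = n" "length offsets = n + 1" "length (concat adj) = m"
    by (simp_all add: weights_def offsets_def n_def m_def)
  have words: "input_words w q as bs adj = [nA, n - nA, q] @ weights @ offsets @ concat adj"
    using length_adj n_card unfolding input_words_def off_def nA_def weights_def offsets_def by simp
  show "inp 0 = nA" "inp (Suc 0) = n - nA" "inp 2 = q"
    by (auto simp: inp_eq words)
  show "inp (3 + v) = wt v" if "v < n"
  proof -
    have "weights ! v = wt v" using that unfolding weights_def wt_def n_def by (rule nth_map)
    then show ?thesis using that by (simp add: inp_eq words nth_append len)
  qed
  show "inp (3 + n + v) = off v" if "v \<le> n"
  proof -
    have "offsets ! v = off v" using that by (simp add: offsets_def del: upt_Suc)
    then show ?thesis using that by (simp add: inp_eq words nth_append len)
  qed
  show "inp (2 * n + 4 + i) = concat adj ! i" if "i < m"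
    using that by (simp add: inp_eq words nth_append len)
  show "inp i = 0" if "2 * n + 4 + m \<le> i"
    using that by (simp add: inp_eq)
qed

lemma inp_adj:
  assumes "v < n" "i < length (adj ! v)"
  shows "inp (start v + i) = adj ! v ! i"
proof -
  have "off v + i < m" using off_le[of "Suc v"] assms by (simp add: off_Suc)
  then have "inp (start v + i) = concat adj ! (off v + i)"
    using inp_words(6)[of "off v + i"] by (simp add: start_def add.assoc)
  then show ?thesis using nth_concat_offset[of v adj i] assms length_adj by (simp add: off_def)
qed

lemma fin_start: "fin v = start v + length (adj ! v)"
  by (simp add: fin_def start_def off_Suc)

lemma inp_adj_iff:
  assumes "v < n"
  shows "(\<exists>p. start v \<le> p \<and> p < fin v \<and> inp p = u) \<longleftrightarrow> u \<in> set (adj ! v)"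
proof
  assume "\<exists>p. start v \<le> p \<and> p < fin v \<and> inp p = u"
  then obtain p where p: "start v \<le> p" "p < fin v" "inp p = u" by blast
  then have "p - start v < length (adj ! v)" "p = start v + (p - start v)" by (auto simp: fin_start)
  then show "u \<in> set (adj ! v)" using inp_adj[OF assms] p(3) by (metis nth_mem)
next
  assume "u \<in> set (adj ! v)"
  then obtain i where "i < length (adj ! v)" "adj ! v ! i = u" by (meson in_set_conv_nth)
  then show "\<exists>p. start v \<le> p \<and> p < fin v \<and> inp p = u"
    using inp_adj[OF assms] by (intro exI[of _ "start v + i"]) (simp add: fin_start)
qed

section \<open>Size bounds in terms of edges and weights\<close>

lemma degree_sums:
  "(\<Sum>v<nA. length (adj ! v)) \<le> card E" "(\<Sum>v=nA..<n. length (adj ! v)) \<le> card E"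
proof -
  have card: "(\<Sum>v\<in>I. length (adj ! v)) = card (SIGMA v:I. set (adj ! v))" if "I \<subseteq> {..<n}" for I
  proof -
    have "card (SIGMA v:I. set (adj ! v)) = (\<Sum>v\<in>I. card (set (adj ! v)))"
      using that finite_subset[OF that] by (intro card_SigmaI) auto
    also have "\<dots> = (\<Sum>v\<in>I. length (adj ! v))"
      using that adj_distinct by (intro sum.cong) (auto intro!: distinct_card)
    finally show ?thesis ..
  qed
  \<comment> \<open>By \<open>sep\<close> only one end of an edge belongs to \<open>I\<close>; so an
    edge determines which end comes first and is counted once.\<close>
  have le: "card (SIGMA v:I. set (adj ! v)) \<le> card E"
    if I: "I \<subseteq> {..<n}" and sep: "\<And>v u. v \<in> I \<Longrightarrow> u \<in> set (adj ! v) \<Longrightarrow> u \<notin> I" for I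
  proof (rule card_inj_on_le)
    show "inj_on (\<lambda>(v, u). {vs ! v, vs ! u}) (SIGMA v:I. set (adj ! v))"
    proof (rule inj_onI, clarsimp)
      fix v u v' u' assume vu: "v \<in> I" "u \<in> set (adj ! v)" "v' \<in> I" "u' \<in> set (adj ! v')"
        and eq: "{vs ! v, vs ! u} = {vs ! v', vs ! u'}"
      have lt: "v < n" "v' < n" "u < n" "u' < n" using I vu adj_sym by auto
      from eq have "vs ! v = vs ! v' \<and> vs ! u = vs ! u' \<or> vs ! v = vs ! u' \<and> vs ! u = vs ! v'"
        by (simp add: doubleton_eq_iff)
      then show "v = v' \<and> u = u'" using vs_eq_iff lt sep vu by metis
    qed
    show "(\<lambda>(v, u). {vs ! v, vs ! u}) ` (SIGMA v:I. set (adj ! v)) \<subseteq> E"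
      using I adj_set by auto
  qed (rule finite_E)
  show "(\<Sum>v<nA. length (adj ! v)) \<le> card E"
    using card[of "{..<nA}"] le[of "{..<nA}"] adj_A n_card by fastforce
  show "(\<Sum>v=nA..<n. length (adj ! v)) \<le> card E"
    using card[of "{nA..<n}"] le[of "{nA..<n}"] adj_B by fastforce
qed

lemma m_le: "m \<le> 2 * card E"
proof -
  have "m = (\<Sum>v<nA. length (adj ! v)) + (\<Sum>v=nA..<n. length (adj ! v))"
    using off_n sum.atLeastLessThan_concat[of 0 nA n "\<lambda>v. length (adj ! v)"] n_card
    by (simp add: off_def atLeast0LessThan)
  then show ?thesis using degree_sums by simp
qed

lemma adj_nonempty: "nA \<le> b \<Longrightarrow> b < n \<Longrightarrow> 0 < length (adj ! b)"
proof -
  assume b: "nA \<le> b" "b < n"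
  then obtain u where u: "{vs ! b, u} \<in> E"
    using no_isolated[OF vertex_B[OF b]] by (auto simp: nbh_def)
  then have "u \<in> set vs" using edges[OF u] vs(2) by (auto simp: doubleton_eq_iff)
  then obtain i where "i < n" "vs ! i = u" by (metis in_set_conv_nth n_def)
  then have "i \<in> set (adj ! b)" using adj_set b u by auto
  then show "0 < length (adj ! b)" by (metis length_pos_if_in_set)
qed

text \<open>Every token has an incident edge, and edges of different tokens are different.\<close>

lemma card_B_le: "n - nA \<le> card E"
proof -
  have "(\<Sum>v=nA..<n. 1) \<le> (\<Sum>v=nA..<n. length (adj ! v))"
    using adj_nonempty by (intro sum_mono) (simp add: Suc_le_eq)
  then show ?thesis using degree_sums(2) by simp
qed

lemma sizes: "0 < nA" "nA < n" "0 < card E"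
proof -
  have "0 < length bs" using B_nonempty vs(4) by auto
  then show "nA < n" using n_card by simp
  then show "0 < card E" using card_B_le by simp
  then obtain e where "e \<in> E" by fastforce
  then have "A \<noteq> {}" using edges by blast
  then show "0 < nA" using n_card finite_AB by (simp add: card_gt_0_iff)
qed

text \<open>The number whose logarithm governs the word size.\<close>

definition magnitude :: nat where "magnitude = n + Max (w ` (A \<union> B))"

lemma w_le: "v < n \<Longrightarrow> wt v + n \<le> magnitude"
  using finite_AB vertex_A vertex_B unfolding magnitude_def wt_def
  by (metis Max_ge UnI1 UnI2 add.commute add_le_mono1 finite_UnI finite_imageI imageI not_le)

lemma magnitude_ge: "n + 1 \<le> magnitude"
  using w_le[of 0] w_pos[of "vs ! 0"] vertex_A[of 0] sizes by (simp add: wt_def)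

lemma wB_facts: "wB \<in> wt ` {nA..<n}" "\<And>b. nA \<le> b \<Longrightarrow> b < n \<Longrightarrow> wt b \<le> wB"
proof -
  have "w ` B = wt ` {nA..<n}" by (subst B_image) (auto simp: wt_def image_image)
  then have "wB = Max (wt ` {nA..<n})" by (simp add: wB_def)
  then show "wB \<in> wt ` {nA..<n}" "\<And>b. nA \<le> b \<Longrightarrow> b < n \<Longrightarrow> wt b \<le> wB"
    using sizes Max_in[of "wt ` {nA..<n}"] by auto
qed

lemma m_le_square: "m \<le> n * n"
proof -
  have "length (adj ! v) \<le> n" if "v < n" for v
  proof -
    have "card (set (adj ! v)) \<le> card {..<n}" using adj_set[OF that] by (intro card_mono) auto
    then show ?thesis using distinct_card[OF adj_distinct[OF that]] by simp
  qed
  then have "off n \<le> (\<Sum>v<n. n)" unfolding off_def by (intro sum_mono) auto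
  then show ?thesis by (simp add: off_n)
qed

lemma magnitude_word: "magnitude ^ 6 \<le> 2 ^ W"
  using W_large n_card by (simp add: magnitude_def)

text \<open>Addresses are at most cubic in \<open>magnitude\<close>, the stack being the largest
  part. Half of the exponent 6 covers this cube, the other half the constant factor:
  \<open>magnitude\<close> is at least 3, and 26 is below \<open>3 ^ 3\<close>.\<close>

lemma cube_word: "k \<le> 26 * magnitude ^ 3 \<Longrightarrow> k < 2 ^ W"
proof -
  assume k: "k \<le> 26 * magnitude ^ 3"
  have s: "3 \<le> magnitude" using magnitude_ge sizes by simp
  have "26 * magnitude ^ 3 < 3 ^ 3 * magnitude ^ 3" using s by simp
  also have "\<dots> \<le> magnitude ^ 3 * magnitude ^ 3" using s by (intro mult_right_mono power_mono) auto
  also have "\<dots> \<le> 2 ^ W" using magnitude_word by (simp flip: power_add)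
  finally show "k < 2 ^ W" using k by simp
qed

sublocale token_graph nA n q wB wt start fin inp
proof
  show "0 < nA" "nA < n" by (fact sizes)+
  show "wB \<le> q" using q_ge by (simp add: wB_def)
  show "0 < wB" using wB_facts(1) w_pos vertex_B by (auto simp: wt_def)
  show "\<And>b. nA \<le> b \<Longrightarrow> b < n \<Longrightarrow> wt b \<le> wB" by (fact wB_facts(2))
  show "\<And>v. start v \<le> fin v" by (simp add: fin_start)
  show "\<And>b. nA \<le> b \<Longrightarrow> b < n \<Longrightarrow> start b < fin b" using adj_nonempty by (simp add: fin_start)
  show "nA \<le> inp p \<and> inp p < n" if "a < nA" "start a \<le> p" "p < fin a" for a p
    using that inp_adj_iff[of a "inp p"] adj_A sizes by auto
  show "inp p < nA \<and> (\<exists>p'. start (inp p) \<le> p' \<and> p' < fin (inp p) \<and> inp p' = b)"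
    if "nA \<le> b" "b < n" "start b \<le> p" "p < fin b" for b p
  proof -
    have u: "inp p \<in> set (adj ! b)" using that inp_adj_iff[of b "inp p"] by auto
    from adj_sym[OF that(2) u] have "\<exists>p'. start (inp p) \<le> p' \<and> p' < fin (inp p) \<and> inp p' = b"
      by (intro iffD2[OF inp_adj_iff]) simp_all
    with adj_B[OF that(1,2) u] show ?thesis by (rule conjI)
  qed
qed

lemma top_label_le: "top_label \<le> n" "top_label \<le> 2 * card E"
  using sizes card_B_le by (auto simp: top_label_def)

sublocale ram_input nA n q wB wt start fin inp m W
proof
  show "inp 0 = nA" "inp (Suc 0) = n - nA" "inp 2 = q"
    "\<And>v. v < n \<Longrightarrow> inp (3 + v) = wt v" "\<And>x. 2 * n + 4 + m \<le> x \<Longrightarrow> inp x = 0"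
    by (fact inp_words)+
  show "2 * n + 4 + inp (3 + n + v) = start v" if "v < n" for v
    using inp_words(5)[of v] that by (simp add: start_def)
  show "2 * n + 4 + inp (3 + n + Suc v) = fin v" if "v < n" for v
    using inp_words(5)[of "Suc v"] that by (simp add: fin_def)
  show "inp (3 + n + n) = m" using inp_words(5)[of n] off_n by simp
  show "\<And>v. v < n \<Longrightarrow> fin v \<le> 2 * n + 4 + m" using off_le by (simp add: fin_def)
  show "q < 2 ^ W" by (fact q_word)
  have n: "n \<le> magnitude" "1 \<le> magnitude" using magnitude_ge by auto
  have s3: "magnitude \<le> magnitude ^ 3" "magnitude ^ 2 \<le> magnitude ^ 3" "1 \<le> magnitude ^ 3"
    using n power_increasing[of 2 3 magnitude] by (auto simp: self_le_power)
  have nn: "n * n \<le> magnitude ^ 3" "n * (n * n) \<le> magnitude ^ 3"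
  proof -
    show "n * n \<le> magnitude ^ 3" using mult_mono[OF n(1) n(1)] s3 by (simp add: power2_eq_square)
    show "n * (n * n) \<le> magnitude ^ 3"
      using mult_mono[OF n(1) mult_mono[OF n(1) n(1)]] by (simp add: power3_eq_cube)
  qed
  have "top_label * (2 * m + n) \<le> n * (2 * (n * n) + n)"
    using top_label_le(1) m_le_square by (intro mult_mono add_mono) auto
  then have "6 * n + m + 5 + (top_label * (2 * m + n) + 2 * m + nA) \<le> 26 * magnitude ^ 3"
    using nn n s3 m_le_square sizes by (simp add: distrib_left)
  then show "6 * n + m + 5 + (top_label * (2 * m + n) + 2 * m + nA) < 2 ^ W"
    by (rule cube_word)
  have "wB \<le> magnitude" "\<And>v. v < n \<Longrightarrow> wt v \<le> magnitude" using wB_facts(1) w_le by fastforce+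
  then have "(\<Sum>v<n. wt v) + wB \<le> (\<Sum>v<n. magnitude) + magnitude"
    by (intro add_mono sum_mono) auto
  also have "\<dots> \<le> magnitude * magnitude" using magnitude_ge mult_right_mono[of "n + 1" magnitude magnitude] by simp
  also have "\<dots> \<le> 26 * magnitude ^ 3" using s3 by (simp add: power2_eq_square)
  finally show "(\<Sum>v<n. wt v) + wB < 2 ^ W" by (rule cube_word)
  show "(\<Sum>v<n. fin v - start v) = m" using off_n by (simp add: fin_start off_def)
  show "wB \<in> wt ` {nA..<n}" by (fact wB_facts(1))
qed

text \<open>The two products with \<open>top_label\<close> call for different bounds on it:
  \<open>n\<close> next to the list lengths, but \<open>2 * card E\<close> next to \<open>n\<close>,
  since \<open>n\<close> may exceed \<open>card E\<close>. The coefficients 4 + 2 + 4 + 1 = 11 lead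
  to 100 * 11 + 150 + 100 = 1350.\<close>

lemma time_bound: "100 * stack_bound + 150 * n + 100 \<le> 1350 * (n * card E)"
proof -
  have E: "1 \<le> card E" and n: "1 \<le> n" using sizes by auto
  define x where "x = n * card E"
  have "top_label * (2 * m) \<le> n * (2 * (2 * card E))"
    using top_label_le(1) m_le by (intro mult_mono) auto
  also have "\<dots> = 4 * x" by (simp add: x_def)
  finally have 1: "top_label * (2 * m) \<le> 4 * x" .
  have "top_label * n \<le> (2 * card E) * n"
    using top_label_le(2) by (intro mult_right_mono) auto
  also have "\<dots> = 2 * x" by (simp add: x_def)
  finally have 2: "top_label * n \<le> 2 * x" .
  have "card E \<le> x" "n \<le> x" using E n by (simp_all add: x_def)
  then have "stack_bound \<le> 11 * x"
    unfolding stack_bound_def distrib_left using 1 2 m_le sizes by linarith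
  then show ?thesis using \<open>n \<le> x\<close> n unfolding x_def[symmetric] by linarith
qed

section \<open>From the final memory to a balanced expansion\<close>

lemma solved_expansion:
  assumes "solved s"
  shows "\<exists>A1 A2 f. output_encodes as bs A1 f (snd s) \<and> balanced_expansion A B E w A1 A2 f q \<and>
    (q * card A \<le> weight w A + weight w B \<longrightarrow> A1 \<noteq> {})"
proof -
  obtain D P Z S k where valid: "valid (D, P, Z, S, 0)" and th: "is_threshold D Z k"
    and out: "\<And>v. v < n \<Longrightarrow> snd s v = (if v < nA then if k \<le> D v then 1 else 0 else Z v)"
    using assms unfolding solved_def by blast
  note final = valid_final[OF valid th]
  \<comment> \<open>Outside the vertices this is an arbitrary number, which affects no condition on
    \<open>f\<close>: images are taken of B and preimages within B.\<close>
  define num where "num x = (THE i. i < n \<and> vs ! i = x)" for x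
  define f where "f x = vs ! Z (num x)" for x
  define A1 where "A1 = (!) vs ` {a. a < nA \<and> k \<le> D a}"
  have num: "num (vs ! i) = i" if "i < n" for i
    unfolding num_def using that vs_eq_iff by (intro the_equality) auto
  have f: "f (vs ! i) = vs ! Z i" if "i < n" for i using num[OF that] by (simp add: f_def)
  have host: "Z b < nA \<and> Z b \<in> set (adj ! b)" if b: "nA \<le> b" "b < n" for b
  proof -
    have "\<And>b. nA \<le> b \<Longrightarrow> b < n \<Longrightarrow> \<exists>p. start b \<le> p \<and> p < fin b \<and> Z b = inp p"
      using valid unfolding valid_def by auto
    then obtain p where p: "start b \<le> p" "p < fin b" "inp p = Z b" using b by metis
    then have "Z b \<in> set (adj ! b)" by (intro iffD1[OF inp_adj_iff[OF b(2)]]) auto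
    then show ?thesis using tgt_B[OF b p(1,2)] p(3) by simp
  qed
  have A1_iff: "vs ! a \<in> A1 \<longleftrightarrow> a < nA \<and> k \<le> D a" if "a < n" for a
  proof
    assume "vs ! a \<in> A1"
    then obtain a' where "vs ! a = vs ! a'" "a' < nA" "k \<le> D a'" by (auto simp: A1_def)
    then show "a < nA \<and> k \<le> D a" using vs_eq_iff[OF that, of a'] sizes by simp
  qed (auto simp: A1_def)
  have fiber: "B \<inter> f -` {vs ! a} = (!) vs ` {b. nA \<le> b \<and> b < n \<and> Z b = a}" if "a < nA" for a
  proof -
    have "vs ! Z b = vs ! a \<longleftrightarrow> Z b = a" if "nA \<le> b" "b < n" for b
      using host[OF that] \<open>a < nA\<close> vs_eq_iff[of "Z b" a] sizes by simp
    then show ?thesis using f by (subst B_image) auto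
  qed
  have load: "w (vs ! a) + weight w (B \<inter> f -` {vs ! a}) = load Z a" if "a < nA" for a
  proof -
    have "inj_on ((!) vs) {b. nA \<le> b \<and> b < n \<and> Z b = a}"
      by (rule inj_on_subset[OF vs_inj]) auto
    then show ?thesis by (simp add: fiber[OF that] sum.reindex load_def wt_def)
  qed
  have "balanced_expansion A B E w A1 (A - A1) f q"
    unfolding balanced_expansion_def
  proof (intro conjI ballI)
    show "A1 \<union> (A - A1) = A" using A_image by (auto simp: A1_def)
    show "f ` B \<subseteq> A" using f host vertex_A by (subst B_image) auto
    fix x assume "x \<in> A1"
    then obtain a where a: "x = vs ! a" "a < nA" "k \<le> D a" by (auto simp: A1_def)
    have "int (w x) + int (weight w (B \<inter> f -` {x})) = int (load Z a)"
      using load[OF a(2)] a(1) by (metis of_nat_add)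
    then show "int q - int (Max (w ` B)) + 1 \<le> int (w x) + int (weight w (B \<inter> f -` {x}))"
      using final(1)[OF a(2,3)] unfolding wB_def by linarith
  next
    fix x assume x: "x \<in> A - A1"
    then obtain a where a: "x = vs ! a" "a < nA" using A_image by auto
    then have "D a < k" using x A1_iff[of a] sizes by auto
    have "int (w x) + int (weight w (B \<inter> f -` {x})) = int (load Z a)"
      using load[OF a(2)] a(1) by (metis of_nat_add)
    \<comment> \<open>The load is even at most \<open>q\<close>; a positive \<open>wB\<close> gives
      the weaker bound.\<close>
    then show "int (w x) + int (weight w (B \<inter> f -` {x})) \<le> int q + int (Max (w ` B)) - 1"
      using final(2)[OF a(2) \<open>D a < k\<close>] wB_pos unfolding wB_def by linarith
  next
    fix x assume "x \<in> B"
    then obtain b where b: "x = vs ! b" "nA \<le> b" "b < n" using B_image by auto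
    then show "f x \<in> nbh E x" using host[OF b(2,3)] adj_set[OF b(3)] f by (auto simp: nbh_def)
  next
    show "nbh_set E (B \<inter> f -` A1) \<subseteq> A1"
    proof
      fix y assume "y \<in> nbh_set E (B \<inter> f -` A1)"
      then obtain x where x: "x \<in> B" "f x \<in> A1" "{x, y} \<in> E" by (auto simp: nbh_set_def nbh_def)
      obtain b where b: "x = vs ! b" "nA \<le> b" "b < n" using x B_image by auto
      have "y \<in> set vs" using edges[OF x(3)] vs(2) by (auto simp: doubleton_eq_iff)
      then obtain u where u: "u < n" "y = vs ! u" by (metis in_set_conv_nth n_def)
      then have ub: "u \<in> set (adj ! b)" using x b adj_set by auto
      then obtain p where p: "start b \<le> p" "p < fin b" "inp p = u" using inp_adj_iff b by blast
      have "k \<le> D (Z b)" using x(2) f[OF b(3)] b host[OF b(2,3)] A1_iff[of "Z b"] sizes by auto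
      then have "k \<le> D u" using final(3)[OF b(2,3) _ p(1,2)] p(3) by simp
      then show "y \<in> A1" using A1_iff u adj_B[OF b(2,3) ub] by simp
    qed
  qed auto
  moreover have "output_encodes as bs A1 f (snd s)"
    unfolding output_encodes_def
  proof (intro conjI allI impI)
    fix i assume "i < length as"
    then show "snd s i = (if as ! i \<in> A1 then 1 else 0)"
      using out[of i] A1_iff[of i] sizes by (simp add: nA_def nth_append)
  next
    fix j assume j: "j < length bs"
    define b where "b = length as + j"
    have b: "nA \<le> b" "b < n" "vs ! b = bs ! j" using j by (auto simp: b_def nA_def n_def nth_append)
    have "snd s b = Z b" using out[OF b(2)] b(1) by simp
    then show "snd s (length as + j) < length as" "as ! snd s (length as + j) = f (bs ! j)"
      using host[OF b(1,2)] f[OF b(2)] b(3) by (simp_all add: nA_def b_def[symmetric] nth_append)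
  qed
  moreover have "A1 \<noteq> {}" if "q * card A \<le> weight w A + weight w B"
  proof -
    have "weight w A + weight w B = weight w (A \<union> B)"
      using finite_AB disjoint by (simp add: sum.union_disjoint)
    also have "A \<union> B = (!) vs ` {..<n}" using vs(2) by (auto simp: n_def set_conv_nth)
    also have "weight w \<dots> = (\<Sum>v<n. wt v)" using vs_inj by (simp add: sum.reindex wt_def)
    finally show ?thesis using final(4) that n_card by (auto simp: A1_def)
  qed
  ultimately show ?thesis by blast
qed

lemma program_correct:
  "\<exists>s A1 A2 f.
     halts_within W (compile 0 expansion_phases) (input_words w q as bs adj)
       (1350 * (card (A \<union> B) * card E)) s \<and>
     output_encodes as bs A1 f (mem s) \<and> balanced_expansion A B E w A1 A2 f q \<and>
     (q * card A \<le> weight w A + weight w B \<longrightarrow> A1 \<noteq> {})"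
proof -
  have start_store: "achieves W expansion_phases (\<lambda>_. 0, mem (init_config (input_words w q as bs adj)))
      (100 * stack_bound + 150 * n + 100) solved"
    using expansion_phases_correct unfolding inp_def .
  obtain s where s: "halts_within W (compile 0 expansion_phases) (input_words w q as bs adj)
      (100 * stack_bound + 150 * n + 100) s" "solved (reg s, mem s)"
    using compile_halts[OF start_store] by blast
  then have "halts_within W (compile 0 expansion_phases) (input_words w q as bs adj)
      (1350 * (card (A \<union> B) * card E)) s"
    using order.trans[OF _ time_bound] unfolding halts_within_def n_card(1)[symmetric] by blast
  then show ?thesis using solved_expansion[OF s(2)] by fastforce
qed

end

text \<open>Turns the logarithmic condition on the word size into an inequality of naturals.\<close>

lemma power_le_of_log:
  assumes "0 < k" "real c * log 2 (real k) \<le> real W"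
  shows "k ^ c \<le> 2 ^ W"
proof -
  have "log 2 (real k ^ c) \<le> real W" using assms by (simp add: log_nat_power)
  then have "real k ^ c \<le> 2 powr real W" using assms(1) by (simp add: log_le_iff)
  also have "\<dots> = 2 ^ W" by (simp add: powr_realpow)
  finally show ?thesis by (metis of_nat_le_iff of_nat_numeral of_nat_power)
qed

theorem theorem2:
  "\<exists>(P :: instr list) (c :: nat) (C :: nat).
     \<forall>(A :: 'v set) (B :: 'v set) (E :: 'v set set) (w :: 'v \<Rightarrow> nat) (q :: nat)
       (as :: 'v list) (bs :: 'v list) (adj :: nat list list) (W :: nat).
       weighted_bipartite_graph A B E w \<longrightarrow>
       B \<noteq> {} \<longrightarrow>
       (\<forall>b\<in>B. nbh E b \<noteq> {}) \<longrightarrow>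
       Max (w ` B) \<le> q \<longrightarrow>
       enumerates as A \<longrightarrow> enumerates bs B \<longrightarrow> adjacency_lists E (as @ bs) adj \<longrightarrow>
       real c * log 2 (real (card (A \<union> B) + Max (w ` (A \<union> B)))) \<le> real W \<longrightarrow>
       q < 2 ^ W \<longrightarrow>
       (\<exists>s A1 A2 f.
          halts_within W P (input_words w q as bs adj) (C * (card (A \<union> B) * card E)) s \<and>
          output_encodes as bs A1 f (mem s) \<and>
          balanced_expansion A B E w A1 A2 f q \<and>
          (weight w A + weight w B \<ge> q * card A \<longrightarrow> A1 \<noteq> {}))"
proof (rule exI[of _ "compile 0 expansion_phases"], rule exI[of _ 6], rule exI[of _ 1350],
    intro allI impI)
  fix A B :: "'v set" and E :: "'v set set" and w :: "'v \<Rightarrow> nat" and q :: nat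
    and as bs :: "'v list" and adj :: "nat list list" and W :: nat
  assume hyps: "weighted_bipartite_graph A B E w" "B \<noteq> {}" "\<forall>b\<in>B. nbh E b \<noteq> {}"
    "Max (w ` B) \<le> q" "enumerates as A" "enumerates bs B" "adjacency_lists E (as @ bs) adj"
    and W: "real 6 * log 2 (real (card (A \<union> B) + Max (w ` (A \<union> B)))) \<le> real W" and "q < 2 ^ W"
  \<comment> \<open>Makes the argument of the logarithm positive.\<close>
  have "0 < card (A \<union> B)"
    using hyps(1,2) by (simp add: weighted_bipartite_graph_def card_gt_0_iff)
  then have "(card (A \<union> B) + Max (w ` (A \<union> B))) ^ 6 \<le> 2 ^ W"
    by (intro power_le_of_log W) simp
  then interpret encoded_graph A B E w q as bs adj W
    using hyps \<open>q < 2 ^ W\<close> by unfold_locales auto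
  show "\<exists>s A1 A2 f.
      halts_within W (compile 0 expansion_phases) (input_words w q as bs adj)
        (1350 * (card (A \<union> B) * card E)) s \<and>
      output_encodes as bs A1 f (mem s) \<and> balanced_expansion A B E w A1 A2 f q \<and>
      (weight w A + weight w B \<ge> q * card A \<longrightarrow> A1 \<noteq> {})"
    by (rule program_correct)
qed

end
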